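(* For every $a>0$ and $t\ge 0$, $$E\big[(A_t-a)^{+}\big]=t-a+a^2\,E\Big[(a+A_t)^{-1}\exp\Big(\frac{2M_t}{a+A_t}-\frac{2}{a}\Big)\Big].$$
   Context: $(B_t)_{t\ge 0}$ is a standard one-dimensional Brownian motion started at $0$, $M_t=\exp(B_t-t/2)$, and $A_t=\int_0^t M_s\,ds$. Here $x^+=\max(x,0)$. *)

theory Defs
  imports "HOL-Probability.Probability"
begin

text \<open>
  Only times \<^term>\<open>t \<ge> (0::real)\<close> matter; nothing is assumed about \<^term>\<open>B t\<close> for negative \<^term>\<open>t\<close>.
  All paths are continuous and the start at 0 is almost sure. Continuity of every path makes the time
  integrals of functions of \<^term>\<open>B\<close> measurable without completing \<^term>\<open>P\<close>.
\<close>

locale standard_brownian_motion = prob_space P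
  for P :: "'w measure" +
  fixes B :: "real \<Rightarrow> 'w \<Rightarrow> real"
  assumes random_variable_B: "\<And>t. 0 \<le> t \<Longrightarrow> random_variable borel (B t)"
    and start: "AE \<omega> in P. B 0 \<omega> = 0"
    and independent_increments:
      "\<And>(n::nat) (t :: nat \<Rightarrow> real). 0 \<le> t 0 \<Longrightarrow> strict_mono_on {..n} t \<Longrightarrow>
         indep_vars (\<lambda>_. borel) (\<lambda>i \<omega>. B (t (Suc i)) \<omega> - B (t i) \<omega>) {..<n}"
    and gaussian_increments:
      "\<And>s t. 0 \<le> s \<Longrightarrow> s < t \<Longrightarrow>
         distributed P lborel (\<lambda>\<omega>. B t \<omega> - B s \<omega>) (normal_density 0 (sqrt (t - s)))"
    and continuous_paths: "\<And>\<omega>. \<omega> \<in> space P \<Longrightarrow> continuous_on {0..} (\<lambda>t. B t \<omega>)"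

definition exp_martingale :: "(real \<Rightarrow> 'w \<Rightarrow> real) \<Rightarrow> real \<Rightarrow> 'w \<Rightarrow> real" where
  "exp_martingale B t \<omega> = exp (B t \<omega> - t / 2)"

definition exp_functional :: "(real \<Rightarrow> 'w \<Rightarrow> real) \<Rightarrow> real \<Rightarrow> 'w \<Rightarrow> real" where
  "exp_functional B t \<omega> = (LINT s:{0..t}|lborel. exp_martingale B s \<omega>)"

end

(*
  Put p(t, a) = E (a - A_t)^+ and psi(a) = a exp (-2 / a). As (x - a)^+ = x - a + (a - x)^+ and E A_t = t, the
  claim is p(t, a) = psi(a) E[(1 + A_t/a)^(-1) exp (2 Z_t)] with Z = (M/a) / (1 + A/a). The function p(., a) is
  governed by the generator a^2/2 d^2/da^2 - d/da, and conjugating by psi and substituting z = 1/a turns this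
  into z^2/2 d^2/dz^2 - z^2 d/dz - z, the generator of Z killed at rate Z (note 1 + A/a = exp of the integral
  of Z). So both sides solve the same evolution equation with initial value a.

  Instead of stochastic calculus, A is replaced by left Riemann sums with step h = s^2. Conditioning on the first
  increment gives exact recursions for both sides, whose one-step kernels differ by O(s^3) on Lipschitz
  functions, locally uniformly in z. To have bounded Lipschitz data, exp (2 z) is first replaced by
  1 / (exp (-2 z) + delta z), which perturbs the payoff a by an amount that is uniformly small as delta -> 0;
  delta is removed at the end by monotone convergence, which also yields the integrability.
*)
theory Submission
  imports Defs
begin

section \<open>The standard Gaussian measure\<close>

text \<open>The put is treated first because it is bounded by a, so that limits under the
  expectation need only dominated convergence; the unbounded call comes back at the end through E
  A_t = t. The factor psi is dictated by the drifts. If L denotes the generator of p, then a^2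
  psi'/psi = a + 2 is exactly what turns the drift -1 into the drift -z^2 of Z after z = 1/a, and L
  psi = -psi/a is the origin of the killing at rate z; so psi is a supersolution.

  Balance of errors: t/s^2 steps with one-step errors of order s^3 leave a total of order s. Errors
  of order s^2 would not vanish in the sum, so the one-step estimate rests on cancellations between
  a Gaussian translation and the weight coming from psi. The obstacle is that its constants blow up
  for large z, that is, for a near 0. A cut at a = \<epsilon> separates the region where both sides
  are small anyway. The limits are taken in the order s -> 0, then \<epsilon> -> 0, then \<delta> ->
  0.\<close>

definition std_gauss :: "real measure" where
  "std_gauss = density lborel std_normal_density"

lemma sets_std_gauss [measurable_cong, simp]: "sets std_gauss = sets borel"
  and space_std_gauss [simp]: "space std_gauss = UNIV"
  by (simp_all add: std_gauss_def)

interpretation std_gauss: prob_space std_gauss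
  unfolding std_gauss_def by (rule prob_space_normal_density) simp

lemma integrable_std_gauss_iff:
  fixes F :: "real \<Rightarrow> real"
  assumes [measurable]: "F \<in> borel_measurable borel"
  shows "integrable std_gauss F \<longleftrightarrow> integrable lborel (\<lambda>x. std_normal_density x * F x)"
  unfolding std_gauss_def by (subst integrable_density) auto

lemma integral_std_gauss_eq:
  fixes F :: "real \<Rightarrow> real"
  assumes [measurable]: "F \<in> borel_measurable borel"
  shows "(\<integral>x. F x \<partial>std_gauss) = (\<integral>x. std_normal_density x * F x \<partial>lborel)"
  unfolding std_gauss_def by (subst integral_density) auto

lemma std_normal_density_shift:
  "std_normal_density (x - c) = std_normal_density x * exp (c * x - c\<^sup>2 / 2)"
  by (simp add: std_normal_density_def mult_exp_exp power2_diff diff_divide_distrib add_divide_distrib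
      algebra_simps)

text \<open>One-dimensional Cameron-Martin formula: completing the square turns a translation by
  \<open>c\<close> into the density exp (c x - c^2/2).\<close>

lemma std_gauss_shift:
  fixes F :: "real \<Rightarrow> real"
  assumes F [measurable]: "F \<in> borel_measurable borel"
  shows integrable_std_gauss_shift: "integrable std_gauss (\<lambda>x. F (x + c)) \<longleftrightarrow>
      integrable std_gauss (\<lambda>x. exp (c * x - c\<^sup>2 / 2) * F x)"
    and integral_std_gauss_shift: "(\<integral>x. F (x + c) \<partial>std_gauss) =
      (\<integral>x. exp (c * x - c\<^sup>2 / 2) * F x \<partial>std_gauss)"
proof -
  have eq: "std_normal_density (x - c) * F x =
      std_normal_density x * (exp (c * x - c\<^sup>2 / 2) * F x)" for x
    by (simp add: std_normal_density_shift)
  show "integrable std_gauss (\<lambda>x. F (x + c)) \<longleftrightarrow>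
      integrable std_gauss (\<lambda>x. exp (c * x - c\<^sup>2 / 2) * F x)"
    by (simp add: integrable_std_gauss_iff
        lborel_integrable_real_affine_iff[of 1 "\<lambda>x. std_normal_density x * F (x + c)" "- c", symmetric]
        eq)
  show "(\<integral>x. F (x + c) \<partial>std_gauss) = (\<integral>x. exp (c * x - c\<^sup>2 / 2) * F x \<partial>std_gauss)"
    by (simp add: integral_std_gauss_eq
        lborel_integral_real_affine[of 1 "\<lambda>x. std_normal_density x * F (x + c)" "- c"]
        eq)
qed

lemma integral_std_gauss_reflect:
  fixes F :: "real \<Rightarrow> real"
  assumes [measurable]: "F \<in> borel_measurable borel"
  shows "(\<integral>x. F (- x) \<partial>std_gauss) = (\<integral>x. F x \<partial>std_gauss)"
proof -
  have [simp]: "std_normal_density (- x) = std_normal_density x" for x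
    by (simp add: std_normal_density_def)
  show ?thesis
    using lborel_integral_real_affine[of "-1" "\<lambda>x. std_normal_density x * F x" 0]
    by (simp add: integral_std_gauss_eq)
qed

lemma integrable_std_gauss_exp_linear: "integrable std_gauss (\<lambda>x. exp (c * x - d))"
proof -
  have "integrable std_gauss (\<lambda>x. exp (c * x - c\<^sup>2 / 2) * 1)"
    by (subst integrable_std_gauss_shift[symmetric]) auto
  from integrable_mult_right[OF this, of "exp (c\<^sup>2 / 2 - d)"]
  show ?thesis by (simp add: mult_exp_exp)
qed

lemma integral_std_gauss_exp_linear [simp]: "(\<integral>x. exp (c * x - c\<^sup>2 / 2) \<partial>std_gauss) = 1"
  using integral_std_gauss_shift[of "\<lambda>_. 1" c] by (simp add: std_gauss.prob_space[simplified])

lemma integrable_std_gauss_exp_abs: "integrable std_gauss (\<lambda>x. exp (c * (1 + \<bar>x\<bar>)))"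
proof (rule Bochner_Integration.integrable_bound)
  show "integrable std_gauss (\<lambda>x. exp (c * x - - c) + exp ((- c) * x - - c))"
    by (intro Bochner_Integration.integrable_add integrable_std_gauss_exp_linear)
  have "exp (c * (1 + \<bar>x\<bar>)) \<le> exp (c * x - - c) + exp ((- c) * x - - c)" for x
    by (auto simp: abs_if algebra_simps)
  then show "AE x in std_gauss. norm (exp (c * (1 + \<bar>x\<bar>))) \<le>
      norm (exp (c * x - - c) + exp ((- c) * x - - c))"
    by (intro AE_I2) (simp add: abs_of_nonneg)
qed simp

lemma std_gauss_mean: "integrable std_gauss (\<lambda>x. x)" "(\<integral>x. x \<partial>std_gauss) = 0"
  by (simp_all add: integrable_std_gauss_iff integral_std_gauss_eq integrable_normal_moment_nz_1
      integral_normal_moment_nz_1)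

text \<open>Let Y = exp (s x - s^2/2). Weighting by Y translates x by s, and reflecting x then gives
  1/Y, because s (s - x) - s^2/2 = -(s x - s^2/2). So the size-biased law of Y is the law of 1/Y.
  This absorbs the factor produced by the homogeneity of the put and the factor a in psi.\<close>

lemma lognormal_size_bias:
  fixes F :: "real \<Rightarrow> real"
  assumes [measurable]: "F \<in> borel_measurable borel"
  shows "(\<integral>x. exp (s * x - s\<^sup>2 / 2) * F (exp (s * x - s\<^sup>2 / 2)) \<partial>std_gauss) =
    (\<integral>x. F (1 / exp (s * x - s\<^sup>2 / 2)) \<partial>std_gauss)"
proof -
  have "(\<integral>x. exp (s * x - s\<^sup>2 / 2) * F (exp (s * x - s\<^sup>2 / 2)) \<partial>std_gauss) =
      (\<integral>x. F (exp (s * (x + s) - s\<^sup>2 / 2)) \<partial>std_gauss)"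
    by (subst integral_std_gauss_shift[where F = "\<lambda>x. F (exp (s * x - s\<^sup>2 / 2))"]) simp_all
  also have "\<dots> = (\<integral>x. F (exp (s * (- x + s) - s\<^sup>2 / 2)) \<partial>std_gauss)"
    by (subst integral_std_gauss_reflect[symmetric]) simp_all
  also have "\<dots> = (\<integral>x. F (1 / exp (s * x - s\<^sup>2 / 2)) \<partial>std_gauss)"
  proof -
    have "s * (- x + s) - s\<^sup>2 / 2 = - (s * x - s\<^sup>2 / 2)" for x
      by (simp add: power2_eq_square field_simps)
    then show ?thesis
      by (simp only: exp_minus inverse_eq_divide)
  qed
  finally show ?thesis .
qed

section \<open>Elementary estimates for the exponential function\<close>

text \<open>The exponential involves an upper bound \<open>b\<close> of \<open>y\<close>, not of its
  absolute value: \<open>log_ratio\<close> is bounded above linearly in the absolute value of x, but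
  below only by an exponential.\<close>

lemma abs_exp_minus_one_le:
  fixes y b :: real
  assumes "y \<le> b" "0 \<le> b"
  shows "\<bar>exp y - 1\<bar> \<le> \<bar>y\<bar> * exp b"
proof (cases "0 \<le> y")
  case True
  have "(1 - y) * exp y \<le> exp (- y) * exp y"
    using exp_ge_add_one_self[of "- y"] by (intro mult_right_mono) auto
  then have "exp y - 1 \<le> y * exp y"
    by (simp add: algebra_simps flip: exp_add)
  also have "\<dots> \<le> y * exp b"
    using True assms by (intro mult_left_mono) auto
  finally show ?thesis using True by simp
next
  case False
  then have "\<bar>exp y - 1\<bar> \<le> \<bar>y\<bar> * 1"
    using exp_ge_add_one_self[of y] exp_le_one_iff[of y] unfolding mult_1_right by linarith
  also have "\<dots> \<le> \<bar>y\<bar> * exp b"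
    using assms by (intro mult_left_mono) auto
  finally show ?thesis .
qed

lemma abs_exp_minus_one_minus_le:
  fixes y b :: real
  assumes "y \<le> b" "0 \<le> b"
  shows "\<bar>exp y - 1 - y\<bar> \<le> y\<^sup>2 * exp b"
proof -
  have nonneg: "0 \<le> exp y - 1 - y"
    using exp_ge_add_one_self[of y] by linarith
  have "exp y - 1 - y \<le> y\<^sup>2 * exp b"
  proof (cases "0 \<le> y")
    case True
    have "exp y - 1 \<le> y * exp y"
      using abs_exp_minus_one_le[of y y] True by simp
    then have "exp y - 1 - y \<le> y * (exp y - 1)"
      by (simp add: algebra_simps)
    also have "\<dots> \<le> y * (y * exp b)"
      using abs_exp_minus_one_le[OF assms] True by (intro mult_left_mono) auto
    finally show ?thesis by (simp add: power2_eq_square)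
  next
    case False
    have "(1 - y) * exp y \<le> exp (- y) * exp y"
      using exp_ge_add_one_self[of "- y"] by (intro mult_right_mono) auto
    then have "(1 - y) * exp y \<le> 1"
      by (simp flip: exp_add)
    then have "(1 - y) * (exp y - 1 - y) \<le> y\<^sup>2"
      by (simp add: algebra_simps power2_eq_square)
    moreover have "1 * (exp y - 1 - y) \<le> (1 - y) * (exp y - 1 - y)"
      using False nonneg by (intro mult_right_mono) auto
    moreover have "y\<^sup>2 * 1 \<le> y\<^sup>2 * exp b"
      using assms by (intro mult_left_mono) auto
    ultimately show ?thesis by simp
  qed
  with nonneg show ?thesis by simp
qed

lemma square_le_two_exp:
  fixes y :: real
  assumes "0 \<le> y"
  shows "y\<^sup>2 \<le> 2 * exp y"
  using exp_lower_Taylor_quadratic[OF assms] assms by simp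

text \<open>The exponent 6 arises twice: as 2 + 2 + 2 from the square of \<open>log_ratio\<close>
  times the exponential of its upper bound, and as 4 + 2 from the first-order error of the density
  times \<open>w x - z\<close>.\<close>

definition exp_abs_moment :: real where
  "exp_abs_moment = (\<integral>x. exp (6 * (1 + \<bar>x\<bar>)) \<partial>std_gauss)"

lemma exp_abs_moment_nonneg: "0 \<le> exp_abs_moment"
  by (simp add: exp_abs_moment_def)

text \<open>The term 9 N^3 bounds the mean \<open>T0\<close>. The factor 256 = 16^2 comes from
  squaring the bound on \<open>log_ratio\<close>; it also covers the cross term, whose constant is
  16 * 2 = 32.\<close>

definition step_const :: "real \<Rightarrow> real" where
  "step_const N = 9 * N ^ 3 + 256 * N\<^sup>2 * exp_abs_moment"

lemma step_const_nonneg: "0 \<le> N \<Longrightarrow> 0 \<le> step_const N"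
  by (simp add: step_const_def exp_abs_moment_nonneg)

section \<open>Comparison of the two one-step kernels\<close>

text \<open>
  One step of the chain \<^term>\<open>z\<close> multiplies by a log-normal variable and divides by \<^term>\<open>1 + u\<close>; the conjugated
  kernel divides by \<^term>\<open>1 - u\<close> and carries the weight \<^term>\<open>exp (2 * z - 2 * z')\<close>. A Gaussian shift by \<open>c\<close> turns
  the second kernel into the first one with density \<open>exp (log_ratio x)\<close>. Here \<open>log_ratio x\<close> has size \<open>s\<^sup>2\<close> but mean
  \<open>T0\<close> of order \<open>s\<^sup>4\<close>, so against a Lipschitz function only an error of order \<open>s\<^sup>3\<close> survives.
\<close>
locale tilt =
  fixes s z N :: real
  assumes z: "0 < z" "z \<le> N" and N: "1 \<le> N" and s: "0 < s" "s * N \<le> 1 / 2"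
begin

definition "u = s\<^sup>2 * z"
definition "k = z / (1 + u)"
text \<open>Since exp (s c) = (1 + u) / (1 - u), translating the Gaussian variable by
  \<open>c\<close> trades the divisor 1 - u for 1 + u.\<close>

definition "c = ln ((1 + u) / (1 - u)) / s"
definition "T0 = ln ((1 - u) * (1 + u)) + 2 * z - 2 * k - c\<^sup>2 / 2"
definition "w x = k * exp (s * x - s\<^sup>2 / 2)"
text \<open>Logarithm of a product of three factors: (1 - u) (1 + u), which collects the prefactors
  of the two kernels, the Cameron-Martin density for \<open>c\<close>, and the weight exp (2 z - 2
  w).\<close>

definition "log_ratio x = ln ((1 - u) * (1 + u)) + (c * x - c\<^sup>2 / 2) + 2 * z - 2 * w x"

lemma s_le: "s \<le> 1 / 2"
proof -
  have "s * 1 \<le> s * N" using N s by (intro mult_left_mono) auto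
  then show ?thesis using s by linarith
qed

lemma sz_le: "s * z \<le> 1 / 2"
proof -
  have "s * z \<le> s * N" using z s by (intro mult_left_mono) auto
  then show ?thesis using s by linarith
qed

lemma u_bounds: "0 < u" "u \<le> 1 / 4"
proof -
  show "0 < u" using z s by (simp add: u_def)
  have "s * (s * z) \<le> (1 / 2) * (1 / 2)"
    using s_le sz_le s z by (intro mult_mono) auto
  then show "u \<le> 1 / 4" by (simp add: u_def power2_eq_square mult.assoc)
qed

lemma k_bounds: "0 < k" "k \<le> z" "z - k \<le> s\<^sup>2 * z\<^sup>2"
proof -
  show "0 < k" "k \<le> z" using z u_bounds by (simp_all add: k_def field_simps)
  have "z - k = u * z / (1 + u)" using u_bounds by (simp add: k_def field_simps)
  also have "\<dots> \<le> u * z" using u_bounds z by (simp add: field_simps)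
  finally show "z - k \<le> s\<^sup>2 * z\<^sup>2" by (simp add: u_def power2_eq_square mult_ac)
qed

text \<open>By second-order bounds for the logarithm, c s = ln (1 + u) - ln (1 - u) is 2 u up to 2
  u^2; dividing by s leaves order s^3.\<close>

lemma c_bound: "\<bar>c - 2 * z * s\<bar> \<le> 2 * s ^ 3 * z\<^sup>2"
proof -
  have "c * s = ln (1 + u) - ln (1 - u)"
    using u_bounds s by (simp add: c_def ln_div)
  moreover have "u - u\<^sup>2 \<le> ln (1 + u)" "ln (1 + u) \<le> u"
    using ln_one_plus_pos_lower_bound[of u] ln_add_one_self_le_self[of u] u_bounds by auto
  moreover have "- u - 2 * u\<^sup>2 \<le> ln (1 - u)" "ln (1 - u) \<le> - u"
    using ln_one_minus_pos_lower_bound[of u] ln_le_minus_one[of "1 - u"] u_bounds by auto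
  moreover have "0 \<le> u\<^sup>2" by simp
  ultimately have "\<bar>c * s - 2 * u\<bar> \<le> 2 * u\<^sup>2"
    by linarith
  moreover have "c * s - 2 * u = (c - 2 * z * s) * s" "2 * u\<^sup>2 = (2 * s ^ 3 * z\<^sup>2) * s"
    by (simp_all add: u_def power2_eq_square power3_eq_cube algebra_simps)
  ultimately have "\<bar>c - 2 * z * s\<bar> * s \<le> (2 * s ^ 3 * z\<^sup>2) * s"
    using s by (simp add: abs_mult)
  then show ?thesis using s by simp
qed

text \<open>This is the coefficient of x in \<open>log_ratio\<close>. The density contributes c x
  and the weight contributes -2 k s x, each of order s; they cancel up to order s^3.\<close>

lemma c_k_bound: "\<bar>c - 2 * k * s\<bar> \<le> 4 * s ^ 3 * N\<^sup>2"
proof -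
  have "2 * s * (z - k) \<le> 2 * s * (s\<^sup>2 * z\<^sup>2)"
    using k_bounds s by (intro mult_left_mono) auto
  moreover have "0 \<le> 2 * s * (z - k)" using k_bounds s by simp
  moreover have "s ^ 3 * z\<^sup>2 \<le> s ^ 3 * N\<^sup>2"
    using z s by (intro mult_left_mono power_mono) auto
  ultimately show ?thesis
    using c_bound by (simp add: power2_eq_square power3_eq_cube algebra_simps abs_le_iff)
qed

text \<open>Both 2 z - 2 k and c^2/2 agree with 2 z u up to order s^4, so they cancel, and ln (1 -
  u^2) is of order u^2. The constants 2 + 2 + 9/2 are rounded up to 9.\<close>

lemma T0_bound: "\<bar>T0\<bar> \<le> 9 * N ^ 3 * s ^ 4"
proof -
  have "u * u \<le> 1 / 4 * (1 / 4)" using u_bounds by (intro mult_mono) auto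
  then have u2: "0 \<le> u\<^sup>2" "u\<^sup>2 \<le> 1 / 2" by (simp_all add: power2_eq_square)
  have "u\<^sup>2 * u\<^sup>2 \<le> u\<^sup>2 * (1/2)" using u2 by (intro mult_left_mono) auto
  then have u4: "2 * (u\<^sup>2)\<^sup>2 \<le> u\<^sup>2" by (simp add: power2_eq_square)
  have e: "(1 - u) * (1 + u) = 1 - u\<^sup>2" by (simp add: power2_eq_square algebra_simps)
  have "- u\<^sup>2 - 2 * (u\<^sup>2)\<^sup>2 \<le> ln (1 - u\<^sup>2)" "ln (1 - u\<^sup>2) \<le> - u\<^sup>2"
    using ln_one_minus_pos_lower_bound[of "u\<^sup>2"] ln_le_minus_one[of "1 - u\<^sup>2"] u2 by auto
  then have 1: "\<bar>ln ((1 - u) * (1 + u))\<bar> \<le> 2 * u\<^sup>2" using u4 u2 unfolding e by linarith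
  have "2 * z - 2 * k - 2 * z * u = - (2 * z * u\<^sup>2 / (1 + u))"
    using u_bounds by (simp add: k_def power2_eq_square field_simps)
  also have "\<bar>\<dots>\<bar> \<le> 2 * z * u\<^sup>2"
    using u_bounds z by (simp add: field_simps)
  finally have 2: "\<bar>2 * z - 2 * k - 2 * z * u\<bar> \<le> 2 * z * u\<^sup>2" .
  \<comment> \<open>The term c^2/2 - 2 z u is half of (c - 2 z s) (c + 2 z s). The first factor is
    of order s^3; the second is 4 z s with a correction of at most z s / 2, whence 9/2.\<close>
  have "s\<^sup>2 * z * (s * z) \<le> 1 / 4 * (s * z)"
    using u_bounds z s by (intro mult_right_mono) (auto simp: u_def)
  then have "2 * s ^ 3 * z\<^sup>2 \<le> 1 / 2 * (s * z)"
    by (simp add: power2_eq_square power3_eq_cube algebra_simps)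
  with c_bound have c': "\<bar>c + 2 * z * s\<bar> \<le> 9 / 2 * (z * s)"
    using mult_pos_pos[OF z(1) s(1)] by (simp add: abs_le_iff algebra_simps)
  have half: "\<bar>X\<bar> \<le> 9 / 2 * s ^ 4 * z ^ 3" if "\<bar>2 * X\<bar> \<le> 9 * s ^ 4 * z ^ 3" for X :: real
    using that unfolding abs_mult abs_numeral mult.assoc by linarith
  have "\<bar>c - 2 * z * s\<bar> * \<bar>c + 2 * z * s\<bar> \<le> (2 * s ^ 3 * z\<^sup>2) * (9 / 2 * (z * s))"
    using c_bound c' s z by (intro mult_mono) auto
  then have "\<bar>(c - 2 * z * s) * (c + 2 * z * s)\<bar> \<le> 9 * s ^ 4 * z ^ 3"
    unfolding abs_mult by (simp add: power2_eq_square power3_eq_cube power4_eq_xxxx algebra_simps)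
  also have "(c - 2 * z * s) * (c + 2 * z * s) = 2 * (c\<^sup>2 / 2 - 2 * z * u)"
    by (simp add: u_def power2_eq_square algebra_simps)
  finally have 3: "\<bar>c\<^sup>2 / 2 - 2 * z * u\<bar> \<le> 9 / 2 * s ^ 4 * z ^ 3"
    by (rule half)
  have "T0 = ln ((1 - u) * (1 + u)) + (2 * z - 2 * k - 2 * z * u) - (c\<^sup>2 / 2 - 2 * z * u)"
    by (simp add: T0_def)
  then have "\<bar>T0\<bar> \<le> 2 * u\<^sup>2 + 2 * z * u\<^sup>2 + 9 / 2 * s ^ 4 * z ^ 3"
    using 1 2 3 by linarith
  also have "\<dots> = s ^ 4 * (2 * z\<^sup>2 + 2 * z ^ 3 + 9 / 2 * z ^ 3)"
    by (simp add: u_def power2_eq_square power3_eq_cube power4_eq_xxxx algebra_simps)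
  also have "\<dots> \<le> s ^ 4 * (2 * N ^ 3 + 2 * N ^ 3 + 9 / 2 * N ^ 3)"
  proof -
    have "z ^ 3 \<le> N ^ 3" using z by (intro power_mono) auto
    moreover have "z\<^sup>2 \<le> N\<^sup>2" using z by (intro power_mono) auto
    moreover have "N ^ 2 \<le> N ^ 3" using N by (intro power_increasing) auto
    ultimately show ?thesis by (intro mult_left_mono add_mono) auto
  qed
  also have "\<dots> \<le> 9 * N ^ 3 * s ^ 4" using N by (simp add: algebra_simps)
  finally show ?thesis .
qed

text \<open>Under the Gaussian law both x and exp (s x - s^2/2) - 1 have mean 0, so this form
  exhibits \<open>T0\<close> as the mean.\<close>

lemma log_ratio_eq: "log_ratio x = T0 + (c - 2 * k * s) * x - 2 * k * (exp (s * x - s\<^sup>2 / 2) - 1 - s * x)"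
  by (simp add: log_ratio_def T0_def w_def algebra_simps)

lemma l_bound: "\<bar>s * x - s\<^sup>2 / 2\<bar> \<le> s * (1 + \<bar>x\<bar>)"
proof -
  have "s * s \<le> s * 1" using s_le s by (intro mult_left_mono) auto
  then have "s\<^sup>2 / 2 \<le> s" using s by (simp add: power2_eq_square)
  moreover have "\<bar>s * x\<bar> = s * \<bar>x\<bar>" using s by (simp add: abs_mult)
  moreover have "\<bar>s * x - s\<^sup>2 / 2\<bar> \<le> \<bar>s * x\<bar> + s\<^sup>2 / 2"
    using abs_triangle_ineq4[of "s * x" "s\<^sup>2 / 2"] by simp
  ultimately show ?thesis by (simp add: algebra_simps)
qed

lemma l_bound': "\<bar>s * x - s\<^sup>2 / 2\<bar> \<le> 1 + \<bar>x\<bar>"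
proof -
  have "s * (1 + \<bar>x\<bar>) \<le> 1 * (1 + \<bar>x\<bar>)" using s_le by (intro mult_right_mono) auto
  then show ?thesis using l_bound[of x] by simp
qed

lemma Ns2: "N * s\<^sup>2 \<le> 1 / 4" "0 \<le> N * s\<^sup>2" "9 * N ^ 3 * s ^ 4 \<le> 9 / 4 * (N * s\<^sup>2)"
  "4 * s ^ 3 * N\<^sup>2 \<le> 2 * (N * s\<^sup>2)" "N\<^sup>2 * s\<^sup>2 \<le> N * s / 2"
proof -
  have "(s * N) * s \<le> 1/2 * (1/2)" using s s_le N by (intro mult_mono) auto
  then show "N * s\<^sup>2 \<le> 1 / 4" by (simp add: power2_eq_square mult_ac)
  show nn: "0 \<le> N * s\<^sup>2" using N by simp
  have "(s * N) * (s * N) \<le> 1/2 * (1/2)" using s N by (intro mult_mono) auto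
  then have "(s * N) * (s * N) * (N * s\<^sup>2) \<le> (1/4) * (N * s\<^sup>2)"
    using nn by (intro mult_right_mono) auto
  then show "9 * N ^ 3 * s ^ 4 \<le> 9 / 4 * (N * s\<^sup>2)"
    by (simp add: power2_eq_square power3_eq_cube power4_eq_xxxx mult_ac)
  have "(s * N) * (N * s\<^sup>2) \<le> (1/2) * (N * s\<^sup>2)"
    using nn s by (intro mult_right_mono) auto
  then show "4 * s ^ 3 * N\<^sup>2 \<le> 2 * (N * s\<^sup>2)"
    by (simp add: power2_eq_square power3_eq_cube mult_ac)
  have "(s * N) * (s * N) \<le> 1/2 * (s * N)" using s N by (intro mult_right_mono) auto
  then show "N\<^sup>2 * s\<^sup>2 \<le> N * s / 2" by (simp add: power2_eq_square mult_ac)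
qed

lemma exp_l: "\<bar>exp (s * x - s\<^sup>2 / 2) - 1 - (s * x - s\<^sup>2 / 2)\<bar> \<le> s\<^sup>2 * (2 * exp (2 * (1 + \<bar>x\<bar>)))"
proof -
  have "\<bar>exp (s * x - s\<^sup>2 / 2) - 1 - (s * x - s\<^sup>2 / 2)\<bar> \<le> (s * x - s\<^sup>2 / 2)\<^sup>2 * exp (1 + \<bar>x\<bar>)"
    using l_bound'[of x] by (intro abs_exp_minus_one_minus_le) auto
  also have "\<dots> \<le> (s\<^sup>2 * (2 * exp (1 + \<bar>x\<bar>))) * exp (1 + \<bar>x\<bar>)"
  proof (intro mult_right_mono)
    have "(s * x - s\<^sup>2 / 2)\<^sup>2 = \<bar>s * x - s\<^sup>2 / 2\<bar>\<^sup>2" by simp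
    also have "\<dots> \<le> (s * (1 + \<bar>x\<bar>))\<^sup>2"
      using l_bound by (intro power_mono) auto
    also have "\<dots> = s\<^sup>2 * (1 + \<bar>x\<bar>)\<^sup>2" by (simp add: power_mult_distrib)
    also have "\<dots> \<le> s\<^sup>2 * (2 * exp (1 + \<bar>x\<bar>))"
      using square_le_two_exp[of "1 + \<bar>x\<bar>"] by (intro mult_left_mono) auto
    finally show "(s * x - s\<^sup>2 / 2)\<^sup>2 \<le> s\<^sup>2 * (2 * exp (1 + \<bar>x\<bar>))" .
  qed auto
  also have "exp (2 * (1 + \<bar>x\<bar>)) = exp (1 + \<bar>x\<bar>) * exp (1 + \<bar>x\<bar>)"
    by (simp flip: exp_add)
  ultimately show ?thesis by (simp add: mult_ac)
qed

lemma log_ratio_abs: "\<bar>log_ratio x\<bar> \<le> 16 * (N * s\<^sup>2) * exp (2 * (1 + \<bar>x\<bar>))"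
  and log_ratio_upper: "log_ratio x \<le> 2 * (1 + \<bar>x\<bar>)"
proof -
  define y where "y = 1 + \<bar>x\<bar>"
  define R where "R = exp (s * x - s\<^sup>2 / 2) - 1 - (s * x - s\<^sup>2 / 2)"
  define p where "p = N * s\<^sup>2"
  define e where "e = exp (2 * y)"
  define q where "q = (c - 2 * k * s) * x"
  have y: "1 \<le> y" by (simp add: y_def)
  have ye: "y \<le> e"
    using exp_ge_add_one_self[of "2 * y"] y unfolding e_def by linarith
  have R: "R \<le> s\<^sup>2 * (2 * e)" "0 \<le> R"
  proof -
    show "R \<le> s\<^sup>2 * (2 * e)"
      using exp_l[of x] unfolding R_def e_def y_def by linarith
    show "0 \<le> R"
      using exp_ge_add_one_self[of "s * x - s\<^sup>2 / 2"] unfolding R_def by linarith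
  qed
  have p: "0 \<le> p" "p \<le> 1 / 4" using Ns2 by (simp_all add: p_def)
  \<comment> \<open>\<open>R\<close> is the Taylor remainder at the full exponent s x - s^2/2; the
    difference from s x accounts for the term k s^2.\<close>
  have eq: "log_ratio x = T0 + q - 2 * (k * R) + k * s\<^sup>2"
    unfolding log_ratio_eq R_def q_def by (simp add: algebra_simps)
  have t: "\<bar>T0\<bar> \<le> 9 / 4 * p" using T0_bound Ns2 unfolding p_def by linarith
  have "\<bar>c - 2 * k * s\<bar> \<le> 2 * p" using c_k_bound Ns2 unfolding p_def by linarith
  then have q: "\<bar>q\<bar> \<le> 2 * p * y"
    unfolding q_def abs_mult using p by (intro mult_mono) (auto simp: y_def)
  have kN: "0 \<le> k" "k \<le> N" using k_bounds z by auto
  have "k * R \<le> N * (s\<^sup>2 * (2 * e))"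
    using R kN N by (intro mult_mono) auto
  then have kR: "k * R \<le> 2 * (p * e)" "0 \<le> k * R"
    using kN R by (simp_all add: p_def mult_ac)
  have ks: "k * s\<^sup>2 \<le> p" "0 \<le> k * s\<^sup>2" using kN by (auto simp: p_def intro: mult_right_mono)
  have py: "p * 1 \<le> p * y" "p * y \<le> p * e" "p * y \<le> 1 / 4 * y"
    using y ye p by (intro mult_left_mono mult_right_mono; simp)+
  have "\<bar>T0 + q - 2 * (k * R) + k * s\<^sup>2\<bar> \<le> 16 * (p * e)"
    using t q kR ks py unfolding abs_le_iff by linarith
  then show "\<bar>log_ratio x\<bar> \<le> 16 * (N * s\<^sup>2) * exp (2 * (1 + \<bar>x\<bar>))"
    by (simp add: eq p_def e_def y_def mult.assoc)
  \<comment> \<open>The nonnegative remainder \<open>R\<close> enters with a minus sign and drops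
    out, so the exponential growth affects the lower bound alone.\<close>
  have "T0 + q - 2 * (k * R) + k * s\<^sup>2 \<le> 2 * y"
    using t q kR ks py y p unfolding abs_le_iff by linarith
  then show "log_ratio x \<le> 2 * (1 + \<bar>x\<bar>)"
    unfolding eq y_def .
qed

lemma w_pos: "0 < w x" using k_bounds by (simp add: w_def)

lemma w_dist: "\<bar>w x - z\<bar> \<le> 2 * (N * s) * exp (2 * (1 + \<bar>x\<bar>))"
proof -
  define y where "y = 1 + \<bar>x\<bar>"
  have y: "1 \<le> y" by (simp add: y_def)
  have "\<bar>exp (s * x - s\<^sup>2 / 2) - 1\<bar> \<le> \<bar>s * x - s\<^sup>2 / 2\<bar> * exp y"
    using l_bound'[of x] by (intro abs_exp_minus_one_le) (auto simp: y_def)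
  also have "\<dots> \<le> s * y * exp y"
    using l_bound[of x] by (intro mult_right_mono) (auto simp: y_def)
  also have "\<dots> \<le> s * exp y * exp y"
  proof (intro mult_right_mono mult_left_mono)
    show "y \<le> exp y" using exp_ge_add_one_self[of y] by linarith
  qed (use s in auto)
  also have "\<dots> = s * exp (2 * y)" by (simp flip: exp_add)
  finally have "k * \<bar>exp (s * x - s\<^sup>2 / 2) - 1\<bar> \<le> N * (s * exp (2 * y))"
    using k_bounds z by (intro mult_mono) auto
  moreover have "\<bar>w x - z\<bar> \<le> k * \<bar>exp (s * x - s\<^sup>2 / 2) - 1\<bar> + (z - k)"
  proof -
    have "w x - z = k * (exp (s * x - s\<^sup>2 / 2) - 1) - (z - k)"
      by (simp add: w_def algebra_simps)
    then have "\<bar>w x - z\<bar> \<le> \<bar>k * (exp (s * x - s\<^sup>2 / 2) - 1)\<bar> + \<bar>z - k\<bar>"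
      by (simp only: abs_triangle_ineq4)
    then show ?thesis using k_bounds by (simp add: abs_mult)
  qed
  moreover have "z - k \<le> N * s / 2"
  proof -
    have "s\<^sup>2 * z\<^sup>2 \<le> s\<^sup>2 * N\<^sup>2" using z by (intro mult_left_mono power_mono) auto
    then show ?thesis using k_bounds(3) Ns2(5) by (simp add: mult.commute)
  qed
  moreover have "N * s * 1 \<le> N * s * exp (2 * y)" "0 \<le> N * s"
    using N s y by (auto intro!: mult_left_mono)
  ultimately have "\<bar>w x - z\<bar> \<le> 2 * (N * s * exp (2 * y))"
    unfolding mult.assoc[symmetric] by linarith
  then show ?thesis by (simp add: y_def mult.assoc)
qed

lemma exp_log_ratio_first_order: "\<bar>exp (log_ratio x) - 1\<bar> \<le> 16 * (N * s\<^sup>2) * exp (4 * (1 + \<bar>x\<bar>))"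
proof -
  have "\<bar>exp (log_ratio x) - 1\<bar> \<le> \<bar>log_ratio x\<bar> * exp (2 * (1 + \<bar>x\<bar>))"
    using log_ratio_upper by (intro abs_exp_minus_one_le) auto
  also have "\<dots> \<le> 16 * (N * s\<^sup>2) * exp (2 * (1 + \<bar>x\<bar>)) * exp (2 * (1 + \<bar>x\<bar>))"
    using log_ratio_abs by (intro mult_right_mono) auto
  finally show ?thesis by (simp add: mult.assoc flip: exp_add)
qed

lemma exp_log_ratio_second_order:
  "\<bar>exp (log_ratio x) - 1 - log_ratio x\<bar> \<le> 256 * (N\<^sup>2 * s ^ 4) * exp (6 * (1 + \<bar>x\<bar>))"
proof -
  have "\<bar>exp (log_ratio x) - 1 - log_ratio x\<bar> \<le> (log_ratio x)\<^sup>2 * exp (2 * (1 + \<bar>x\<bar>))"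
    using log_ratio_upper by (intro abs_exp_minus_one_minus_le) auto
  also have "(log_ratio x)\<^sup>2 = \<bar>log_ratio x\<bar>\<^sup>2" by simp
  also have "\<dots> * exp (2 * (1 + \<bar>x\<bar>)) \<le> (16 * (N * s\<^sup>2) * exp (2 * (1 + \<bar>x\<bar>)))\<^sup>2 * exp (2 * (1 + \<bar>x\<bar>))"
    using log_ratio_abs by (intro mult_right_mono power_mono) auto
  also have "\<dots> = 256 * (N\<^sup>2 * s ^ 4) * (exp (2 * (1 + \<bar>x\<bar>)) * exp (2 * (1 + \<bar>x\<bar>)) * exp (2 * (1 + \<bar>x\<bar>)))"
    by (simp add: power2_eq_square power4_eq_xxxx mult_ac)
  also have "\<dots> = 256 * (N\<^sup>2 * s ^ 4) * exp (6 * (1 + \<bar>x\<bar>))"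
    by (simp flip: exp_add)
  finally show ?thesis .
qed

lemma measurable_w_log_ratio [measurable]: "w \<in> borel_measurable borel" "log_ratio \<in> borel_measurable borel"
  unfolding w_def[abs_def] log_ratio_def[abs_def] by measurable

lemma integral_log_ratio: "integrable std_gauss log_ratio" "(\<integral>x. log_ratio x \<partial>std_gauss) = T0"
proof -
  have i: "integrable std_gauss (\<lambda>x. exp (s * x - s\<^sup>2 / 2))"
    by (rule integrable_std_gauss_exp_linear)
  show "integrable std_gauss log_ratio"
    unfolding log_ratio_eq[abs_def] using i std_gauss_mean
    by (intro Bochner_Integration.integrable_add Bochner_Integration.integrable_diff
        integrable_mult_right) auto
  show "(\<integral>x. log_ratio x \<partial>std_gauss) = T0"
    unfolding log_ratio_eq[abs_def] using i std_gauss_mean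
    by (simp add: std_gauss.prob_space[simplified])
qed

lemma tilt_error:
  fixes \<phi> :: "real \<Rightarrow> real"
  assumes \<phi> [measurable]: "\<phi> \<in> borel_measurable borel"
    and bound: "\<And>x. 0 < x \<Longrightarrow> \<bar>\<phi> x\<bar> \<le> C"
    and lip: "\<And>x y. 0 < x \<Longrightarrow> 0 < y \<Longrightarrow> \<bar>\<phi> x - \<phi> y\<bar> \<le> L * \<bar>x - y\<bar>"
  shows "integrable std_gauss (\<lambda>x. exp (log_ratio x) * \<phi> (w x))"
    and "integrable std_gauss (\<lambda>x. \<phi> (w x))"
    and "\<bar>(\<integral>x. exp (log_ratio x) * \<phi> (w x) \<partial>std_gauss) - (\<integral>x. \<phi> (w x) \<partial>std_gauss)\<bar> \<le>
      step_const N * s ^ 3 * (C + L)"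
proof -
  have C: "0 \<le> C" using bound[of 1] by simp
  have L: "0 \<le> L" using lip[of 1 2] by simp
  have i6: "integrable std_gauss (\<lambda>x. exp (6 * (1 + \<bar>x\<bar>)))"
    by (rule integrable_std_gauss_exp_abs)
  show i1: "integrable std_gauss (\<lambda>x. \<phi> (w x))"
    using bound[OF w_pos] by (intro std_gauss.integrable_const_bound[of _ C] AE_I2) auto
  have iex: "integrable std_gauss (\<lambda>x. exp (log_ratio x))"
  proof (rule Bochner_Integration.integrable_bound[OF integrable_std_gauss_exp_abs[of 2]])
    show "AE x in std_gauss. norm (exp (log_ratio x)) \<le> norm (exp (2 * (1 + \<bar>x\<bar>)))"
      using log_ratio_upper by (intro AE_I2) simp
  qed simp
  show i2: "integrable std_gauss (\<lambda>x. exp (log_ratio x) * \<phi> (w x))"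
  proof (rule Bochner_Integration.integrable_bound)
    show "integrable std_gauss (\<lambda>x. C * exp (log_ratio x))"
      using iex by simp
    show "AE x in std_gauss. norm (exp (log_ratio x) * \<phi> (w x)) \<le> norm (C * exp (log_ratio x))"
      using bound[OF w_pos] C by (intro AE_I2) (simp add: abs_mult)
  qed simp
  \<comment> \<open>The difference is expanded around the constant \<phi> z. The second-order term
    is of order s^4, and so is the linear one, whose mean is T0 \<phi> z. The last term multiplies a
    density error of order s^2 by a displacement of order s, and it alone determines the rate
    s^3.\<close>
  let ?a = "\<lambda>x. (exp (log_ratio x) - 1 - log_ratio x) * \<phi> z"
  let ?b = "\<lambda>x. (exp (log_ratio x) - 1) * (\<phi> (w x) - \<phi> z)"
  have eq: "exp (log_ratio x) * \<phi> (w x) - \<phi> (w x) = ?a x + log_ratio x * \<phi> z + ?b x" for x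
    by (simp add: algebra_simps)
  have ia: "integrable std_gauss ?a" and iex': "integrable std_gauss (\<lambda>x. log_ratio x * \<phi> z)"
    using iex integral_log_ratio by auto
  have "integrable std_gauss (\<lambda>x. (exp (log_ratio x) * \<phi> (w x) - \<phi> (w x)) - (?a x + log_ratio x * \<phi> z))"
    using i1 i2 ia iex' by (intro Bochner_Integration.integrable_diff Bochner_Integration.integrable_add)
  then have ib: "integrable std_gauss ?b" by (simp add: eq)
  have "(\<integral>x. exp (log_ratio x) * \<phi> (w x) \<partial>std_gauss) - (\<integral>x. \<phi> (w x) \<partial>std_gauss) =
      (\<integral>x. ?a x + log_ratio x * \<phi> z + ?b x \<partial>std_gauss)"
    using i1 i2 by (simp add: eq[symmetric])
  also have "\<dots> = (\<integral>x. ?a x \<partial>std_gauss) + T0 * \<phi> z + (\<integral>x. ?b x \<partial>std_gauss)"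
    using ia iex' ib integral_log_ratio by simp
  finally have split: "(\<integral>x. exp (log_ratio x) * \<phi> (w x) \<partial>std_gauss) - (\<integral>x. \<phi> (w x) \<partial>std_gauss) =
      (\<integral>x. ?a x \<partial>std_gauss) + T0 * \<phi> z + (\<integral>x. ?b x \<partial>std_gauss)" .
  have "\<bar>\<integral>x. ?a x \<partial>std_gauss\<bar> \<le> (\<integral>x. \<bar>?a x\<bar> \<partial>std_gauss)"
    by (rule integral_abs_bound)
  also have "\<dots> \<le> (\<integral>x. (256 * (N\<^sup>2 * s ^ 4) * C) * exp (6 * (1 + \<bar>x\<bar>)) \<partial>std_gauss)"
  proof (rule integral_mono)
    fix x
    have "\<bar>exp (log_ratio x) - 1 - log_ratio x\<bar> * \<bar>\<phi> z\<bar> \<le> (256 * (N\<^sup>2 * s ^ 4) * exp (6 * (1 + \<bar>x\<bar>))) * C"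
      using exp_log_ratio_second_order bound[OF z(1)] by (intro mult_mono) auto
    then show "\<bar>?a x\<bar> \<le> (256 * (N\<^sup>2 * s ^ 4) * C) * exp (6 * (1 + \<bar>x\<bar>))"
      by (simp add: abs_mult mult_ac)
  qed (use ia i6 in auto)
  finally have a: "\<bar>\<integral>x. ?a x \<partial>std_gauss\<bar> \<le> 256 * (N\<^sup>2 * s ^ 4) * C * exp_abs_moment"
    by (simp add: exp_abs_moment_def)
  have "\<bar>\<integral>x. ?b x \<partial>std_gauss\<bar> \<le> (\<integral>x. \<bar>?b x\<bar> \<partial>std_gauss)"
    by (rule integral_abs_bound)
  also have "\<dots> \<le> (\<integral>x. (32 * (N\<^sup>2 * s ^ 3) * L) * exp (6 * (1 + \<bar>x\<bar>)) \<partial>std_gauss)"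
  proof (rule integral_mono)
    fix x
    have "\<bar>\<phi> (w x) - \<phi> z\<bar> \<le> L * \<bar>w x - z\<bar>" using lip[OF w_pos z(1)] .
    also have "\<dots> \<le> L * (2 * (N * s) * exp (2 * (1 + \<bar>x\<bar>)))"
      using w_dist L by (intro mult_left_mono)
    finally have "\<bar>exp (log_ratio x) - 1\<bar> * \<bar>\<phi> (w x) - \<phi> z\<bar> \<le>
        (16 * (N * s\<^sup>2) * exp (4 * (1 + \<bar>x\<bar>))) * (L * (2 * (N * s) * exp (2 * (1 + \<bar>x\<bar>))))"
      using exp_log_ratio_first_order[of x] by (intro mult_mono) auto
    also have "\<dots> = (32 * (N\<^sup>2 * s ^ 3) * L) * (exp (4 * (1 + \<bar>x\<bar>)) * exp (2 * (1 + \<bar>x\<bar>)))"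
      by (simp add: power2_eq_square power3_eq_cube mult_ac)
    finally show "\<bar>?b x\<bar> \<le> (32 * (N\<^sup>2 * s ^ 3) * L) * exp (6 * (1 + \<bar>x\<bar>))"
      by (simp add: abs_mult flip: exp_add)
  qed (use ib i6 in auto)
  finally have b: "\<bar>\<integral>x. ?b x \<partial>std_gauss\<bar> \<le> 32 * (N\<^sup>2 * s ^ 3) * L * exp_abs_moment"
    by (simp add: exp_abs_moment_def)
  have t: "\<bar>T0 * \<phi> z\<bar> \<le> 9 * N ^ 3 * s ^ 4 * C"
    unfolding abs_mult using T0_bound bound[OF z(1)] by (intro mult_mono) auto
  note W = exp_abs_moment_nonneg
  have s43: "s ^ 4 \<le> s ^ 3" using s s_le by (intro power_decreasing) auto
  have "256 * (N\<^sup>2 * s ^ 4) * C * exp_abs_moment = s ^ 4 * (256 * N\<^sup>2 * exp_abs_moment * C)" by (simp add: mult_ac)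
  also have "\<dots> \<le> s ^ 3 * (256 * N\<^sup>2 * exp_abs_moment * C)" using s43 C W by (intro mult_right_mono) auto
  finally have a': "256 * (N\<^sup>2 * s ^ 4) * C * exp_abs_moment \<le> s ^ 3 * (256 * N\<^sup>2 * exp_abs_moment * C)" .
  have "9 * N ^ 3 * s ^ 4 * C = s ^ 4 * (9 * N ^ 3 * C)" by (simp add: mult_ac)
  also have "\<dots> \<le> s ^ 3 * (9 * N ^ 3 * C)" using s43 C N by (intro mult_right_mono) auto
  finally have t': "9 * N ^ 3 * s ^ 4 * C \<le> s ^ 3 * (9 * N ^ 3 * C)" .
  have "32 * (N\<^sup>2 * s ^ 3) * L * exp_abs_moment = 32 * (s ^ 3 * (N\<^sup>2 * exp_abs_moment * L))" by (simp add: mult_ac)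
  also have "\<dots> \<le> 256 * (s ^ 3 * (N\<^sup>2 * exp_abs_moment * L))" using s L W by (intro mult_right_mono) auto
  finally have b': "32 * (N\<^sup>2 * s ^ 3) * L * exp_abs_moment \<le> 256 * (s ^ 3 * (N\<^sup>2 * exp_abs_moment * L))" .
  have l': "0 \<le> s ^ 3 * (9 * N ^ 3 * L)" using s L N by simp
  have "\<bar>(\<integral>x. ?a x \<partial>std_gauss) + T0 * \<phi> z + (\<integral>x. ?b x \<partial>std_gauss)\<bar> \<le>
      s ^ 3 * (256 * N\<^sup>2 * exp_abs_moment * C) + s ^ 3 * (9 * N ^ 3 * C) + 256 * (s ^ 3 * (N\<^sup>2 * exp_abs_moment * L)) +
      s ^ 3 * (9 * N ^ 3 * L)"
    using a b t a' b' t' l' unfolding abs_le_iff by linarith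
  also have "\<dots> = step_const N * s ^ 3 * (C + L)"
    by (simp add: step_const_def algebra_simps)
  finally show "\<bar>(\<integral>x. exp (log_ratio x) * \<phi> (w x) \<partial>std_gauss) - (\<integral>x. \<phi> (w x) \<partial>std_gauss)\<bar> \<le>
      step_const N * s ^ 3 * (C + L)"
    unfolding split .
qed

text \<open>\<open>F\<close> is a function of \<open>w (x + c)\<close>. Removing the translation
  produces the Cameron-Martin density, which together with the weight and the factor (1 - u) (1 + u)
  makes up \<open>exp (log_ratio x)\<close>.\<close>

lemma tilt_eq:
  fixes \<phi> :: "real \<Rightarrow> real"
  assumes [measurable]: "\<phi> \<in> borel_measurable borel"
  defines "F \<equiv> \<lambda>x. exp (2 * z - 2 * (z / (1 - u) * exp (s * x - s\<^sup>2 / 2))) *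
      \<phi> (z / (1 - u) * exp (s * x - s\<^sup>2 / 2))"
  shows "integrable std_gauss F \<longleftrightarrow> integrable std_gauss (\<lambda>x. exp (log_ratio x) * \<phi> (w x))"
    and "(1 - u) * (\<integral>x. F x \<partial>std_gauss) = (\<integral>x. exp (log_ratio x) * \<phi> (w x) \<partial>std_gauss) / (1 + u)"
proof -
  have eq: "z / (1 - u) * exp (s * x - s\<^sup>2 / 2) = w (x + c)" for x
  proof -
    have "s * (x + c) - s\<^sup>2 / 2 = (s * x - s\<^sup>2 / 2) + ln ((1 + u) / (1 - u))"
      using s by (simp add: c_def algebra_simps)
    then have "exp (s * (x + c) - s\<^sup>2 / 2) = exp (s * x - s\<^sup>2 / 2) * ((1 + u) / (1 - u))"
      using u_bounds by (simp only: exp_add exp_ln zero_less_divide_iff) simp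
    then show ?thesis
      using u_bounds by (simp add: w_def k_def)
  qed
  define G where "G x = exp (2 * z - 2 * w x) * \<phi> (w x)" for x
  have FG: "F = (\<lambda>x. G (x + c))" by (simp only: F_def G_def eq)
  have [measurable]: "G \<in> borel_measurable borel" unfolding G_def[abs_def] by measurable
  have exG: "exp (log_ratio x) * \<phi> (w x) = ((1 - u) * (1 + u)) * (exp (c * x - c\<^sup>2 / 2) * G x)" for x
  proof -
    have "exp (log_ratio x) = (1 - u) * (1 + u) * exp (c * x - c\<^sup>2 / 2) * exp (2 * z - 2 * w x)"
    proof -
      have "log_ratio x = ln ((1 - u) * (1 + u)) + (c * x - c\<^sup>2 / 2) + (2 * z - 2 * w x)"
        by (simp add: log_ratio_def)
      moreover have "0 < (1 - u) * (1 + u)" using u_bounds by simp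
      ultimately show ?thesis by (simp only: exp_add exp_ln)
    qed
    then show ?thesis by (simp add: G_def)
  qed
  show "integrable std_gauss F \<longleftrightarrow> integrable std_gauss (\<lambda>x. exp (log_ratio x) * \<phi> (w x))"
    unfolding FG exG using u_bounds by (subst integrable_std_gauss_shift) auto
  show "(1 - u) * (\<integral>x. F x \<partial>std_gauss) = (\<integral>x. exp (log_ratio x) * \<phi> (w x) \<partial>std_gauss) / (1 + u)"
    unfolding FG exG using u_bounds by (subst integral_std_gauss_shift) auto
qed

text \<open>The first term is the put kernel conjugated by psi, in the form of
  \<open>tilted_step\<close>; the second is the kernel of the damped recursion. By
  \<open>tilt_eq\<close> they differ only through the density, and dividing by 1 + u can only shrink
  the error.\<close>

lemma one_step:
  fixes \<phi> :: "real \<Rightarrow> real"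
  assumes \<phi> [measurable]: "\<phi> \<in> borel_measurable borel"
    and bound: "\<And>x. 0 < x \<Longrightarrow> \<bar>\<phi> x\<bar> \<le> C"
    and lip: "\<And>x y. 0 < x \<Longrightarrow> 0 < y \<Longrightarrow> \<bar>\<phi> x - \<phi> y\<bar> \<le> L * \<bar>x - y\<bar>"
  defines "F \<equiv> \<lambda>x. exp (2 * z - 2 * (z / (1 - u) * exp (s * x - s\<^sup>2 / 2))) *
      \<phi> (z / (1 - u) * exp (s * x - s\<^sup>2 / 2))"
  shows "integrable std_gauss F"
    and "\<bar>(1 - u) * (\<integral>x. F x \<partial>std_gauss) -
        (\<integral>x. \<phi> (z / (1 + u) * exp (s * x - s\<^sup>2 / 2)) \<partial>std_gauss) / (1 + u)\<bar> \<le>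
      step_const N * s ^ 3 * (C + L)"
proof -
  note te = tilt_error[OF \<phi> bound lip]
  show "integrable std_gauss F"
    unfolding F_def using tilt_eq(1)[OF \<phi>] te(1) by simp
  have "(1 - u) * (\<integral>x. F x \<partial>std_gauss) -
        (\<integral>x. \<phi> (z / (1 + u) * exp (s * x - s\<^sup>2 / 2)) \<partial>std_gauss) / (1 + u) =
      ((\<integral>x. exp (log_ratio x) * \<phi> (w x) \<partial>std_gauss) - (\<integral>x. \<phi> (w x) \<partial>std_gauss)) / (1 + u)"
    unfolding F_def tilt_eq(2)[OF \<phi>] by (simp add: w_def k_def diff_divide_distrib)
  also have "\<bar>\<dots>\<bar> \<le> \<bar>(\<integral>x. exp (log_ratio x) * \<phi> (w x) \<partial>std_gauss) - (\<integral>x. \<phi> (w x) \<partial>std_gauss)\<bar>"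
    using u_bounds by (simp add: divide_le_eq mult_left_le_one_le mult_le_cancel_left1)
  also note te(3)
  finally show "\<bar>(1 - u) * (\<integral>x. F x \<partial>std_gauss) -
        (\<integral>x. \<phi> (z / (1 + u) * exp (s * x - s\<^sup>2 / 2)) \<partial>std_gauss) / (1 + u)\<bar> \<le>
      step_const N * s ^ 3 * (C + L)" .
qed

end

section \<open>The damped payoff\<close>

text \<open>
  As \<^term>\<open>\<delta>\<close> decreases to 0, \<^term>\<open>damp \<delta> z\<close> increases to \<^term>\<open>exp (2 * z)\<close>, the function in the theorem,
  which is neither bounded nor known to be integrable in advance.
\<close>
definition damp :: "real \<Rightarrow> real \<Rightarrow> real" where
  "damp \<delta> z = 1 / (exp (- (2 * z)) + \<delta> * z)"

lemma measurable_damp [measurable]: "damp \<delta> \<in> borel_measurable borel"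
  unfolding damp_def[abs_def] by measurable

context
  fixes \<delta> :: real
  assumes \<delta>: "0 < \<delta>" "\<delta> \<le> 1"
begin

lemma damp_denominator:
  assumes "0 \<le> z"
  shows "\<delta> / 4 \<le> exp (- (2 * z)) + \<delta> * z"
proof (cases "z \<le> 1 / 4")
  case True
  have "1 - 2 * z \<le> exp (- (2 * z))"
    using exp_ge_add_one_self[of "- (2 * z)"] by linarith
  moreover have "0 \<le> \<delta> * z" using \<delta> assms by simp
  ultimately show ?thesis using True \<delta> by linarith
next
  case False
  then have "\<delta> * (1 / 4) \<le> \<delta> * z" using \<delta> by (intro mult_left_mono) auto
  then show ?thesis using exp_gt_zero[of "- (2 * z)"] by linarith
qed

lemma damp_denominator_pos: "0 \<le> z \<Longrightarrow> 0 < exp (- (2 * z)) + \<delta> * z"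
  using damp_denominator[of z] \<delta> by linarith

lemma damp_pos: "0 \<le> z \<Longrightarrow> 0 < damp \<delta> z"
  using damp_denominator_pos by (simp add: damp_def)

lemma damp_le: "0 \<le> z \<Longrightarrow> damp \<delta> z \<le> 4 / \<delta>"
  using frac_le[of 1 1 "\<delta> / 4" "exp (- (2 * z)) + \<delta> * z"] damp_denominator[of z] \<delta>
  by (simp add: damp_def)

lemma damp_le_inverse: "0 < z \<Longrightarrow> damp \<delta> z \<le> 1 / (\<delta> * z)"
  unfolding damp_def using \<delta> by (intro frac_le) auto

lemma damp_le_exp: "0 \<le> z \<Longrightarrow> damp \<delta> z \<le> exp (2 * z)"
  using frac_le[of 1 1 "exp (- (2 * z))" "exp (- (2 * z)) + \<delta> * z"] \<delta>
  by (simp add: damp_def exp_minus inverse_eq_divide)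

text \<open>The bound is uniform in z: for z at least 1/e the decay of \<open>damp\<close> gives e,
  and for smaller z \<open>damp\<close> is at most exp (2/e). It serves as the initial error \<beta>
  of the comparison, made small by fixing e and then letting \<delta> tend to 0.\<close>

lemma damp_small:
  assumes "0 < e" "0 < z"
  shows "\<delta> * damp \<delta> z \<le> e + \<delta> * exp (2 / e)"
proof (cases "1 / e \<le> z")
  case True
  have "\<delta> * damp \<delta> z \<le> \<delta> * (1 / (\<delta> * z))"
    using \<delta> damp_le_inverse[OF assms(2)] by (intro mult_left_mono) auto
  also have "\<dots> = 1 / z" using \<delta> by simp
  also have "\<dots> \<le> e" using True assms by (simp add: field_simps)
  finally show ?thesis using \<delta> by (simp add: add_increasing2)
next
  case False
  then have "2 * z \<le> 2 / e" using assms by (simp add: field_simps)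
  then have "damp \<delta> z \<le> exp (2 / e)"
    using damp_le_exp[of z] assms by (meson exp_le_cancel_iff less_imp_le order_trans)
  then have "\<delta> * damp \<delta> z \<le> \<delta> * exp (2 / e)" using \<delta> by (intro mult_left_mono) auto
  then show ?thesis using assms by linarith
qed

lemma exp_neg_lipschitz:
  assumes "0 < x" "x \<le> (y::real)"
  shows "\<bar>exp (- (2 * x)) - exp (- (2 * y))\<bar> \<le> 2 * (y - x)"
proof -
  have "exp (- (2 * x)) - exp (- (2 * y)) = exp (- (2 * x)) * (1 - exp (- (2 * (y - x))))"
    by (simp add: algebra_simps flip: exp_add)
  moreover have "exp (- (2 * x)) * (1 - exp (- (2 * (y - x)))) \<le> 1 * (2 * (y - x))"
  proof (rule mult_mono)
    show "1 - exp (- (2 * (y - x))) \<le> 2 * (y - x)"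
      using exp_ge_add_one_self[of "- (2 * (y - x))"] by linarith
  qed (use assms in auto)
  moreover have "exp (- (2 * y)) \<le> exp (- (2 * x))" using assms by simp
  ultimately show ?thesis by linarith
qed

text \<open>The denominator is Lipschitz with constant 3 and each of the two reciprocals is at most
  4 / \<delta>, which gives 48 = 3 * 4 * 4.\<close>

lemma damp_lipschitz:
  assumes "0 < x" "0 < y"
  shows "\<bar>damp \<delta> x - damp \<delta> y\<bar> \<le> 48 / \<delta>\<^sup>2 * \<bar>x - y\<bar>"
proof -
  let ?D = "\<lambda>z. exp (- (2 * z)) + \<delta> * z"
  have "\<bar>exp (- (2 * x)) - exp (- (2 * y))\<bar> \<le> 2 * \<bar>x - y\<bar>"
    using exp_neg_lipschitz[of x y] exp_neg_lipschitz[of y x] assms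
    by (cases "x \<le> y") (auto simp: abs_minus_commute)
  moreover have "\<bar>\<delta> * x - \<delta> * y\<bar> \<le> 1 * \<bar>x - y\<bar>"
    unfolding right_diff_distrib[symmetric] abs_mult using \<delta> by (intro mult_right_mono) auto
  ultimately have D: "\<bar>?D y - ?D x\<bar> \<le> 3 * \<bar>x - y\<bar>" by linarith
  have pos: "0 < ?D x" "0 < ?D y" using assms damp_denominator_pos by auto
  then have "damp \<delta> x - damp \<delta> y = (?D y - ?D x) * (damp \<delta> x * damp \<delta> y)"
    by (simp add: damp_def field_simps)
  then have "\<bar>damp \<delta> x - damp \<delta> y\<bar> = \<bar>?D y - ?D x\<bar> * (damp \<delta> x * damp \<delta> y)"
    using damp_pos[of x] damp_pos[of y] assms by (simp add: abs_mult)
  also have "\<dots> \<le> (3 * \<bar>x - y\<bar>) * ((4 / \<delta>) * (4 / \<delta>))"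
    using D damp_le[of x] damp_le[of y] damp_pos[of x] damp_pos[of y] assms \<delta>
    by (intro mult_mono) auto
  also have "\<dots> = 48 / \<delta>\<^sup>2 * \<bar>x - y\<bar>" by (simp add: power2_eq_square)
  finally show ?thesis .
qed

text \<open>With z = 1/a the left side is a \<delta> z times \<open>damp \<delta> z\<close>, and a z
  = 1. This is the exact price, at time 0, of damping.\<close>

lemma damp_payoff:
  assumes "0 < a"
  shows "a - a * exp (- 2 / a) * damp \<delta> (1 / a) = \<delta> * damp \<delta> (1 / a)"
proof -
  have "exp (- 2 / a) + \<delta> / a \<noteq> 0"
    using damp_denominator_pos[of "1 / a"] assms by simp
  then show ?thesis using assms by (simp add: damp_def field_simps)
qed

end

lemma integrable_lognormal: "integrable std_gauss (\<lambda>x. exp (s * x - s\<^sup>2 / 2))"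
  by (rule integrable_std_gauss_exp_linear)

lemma integral_lognormal_inverse:
  "integrable std_gauss (\<lambda>x. 1 / exp (s * x - s\<^sup>2 / 2))"
  "(\<integral>x. 1 / exp (s * x - s\<^sup>2 / 2) \<partial>std_gauss) = exp (s\<^sup>2)"
proof -
  have "- (s * x - s\<^sup>2 / 2) = s\<^sup>2 + ((- s) * x - (- s)\<^sup>2 / 2)" for x by simp
  then have eq: "1 / exp (s * x - s\<^sup>2 / 2) = exp (s\<^sup>2) * exp ((- s) * x - (- s)\<^sup>2 / 2)" for x
    by (metis exp_add exp_minus inverse_eq_divide)
  show "integrable std_gauss (\<lambda>x. 1 / exp (s * x - s\<^sup>2 / 2))"
    unfolding eq by (intro integrable_mult_right integrable_lognormal)
  show "(\<integral>x. 1 / exp (s * x - s\<^sup>2 / 2) \<partial>std_gauss) = exp (s\<^sup>2)"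
    unfolding eq
    by (simp only: integral_mult_right_zero integral_std_gauss_exp_linear mult_1_right)
qed

section \<open>Comparison of the recursions\<close>

text \<open>Here \<open>m\<close> counts the steps still to run, \<open>q\<close> is the damped side
  in the variable z, and \<open>r\<close> is the put in the variable a. The recursion for
  \<open>r\<close> is confined to a > s^2 because a left sum of at least one step is at least s^2,
  so the put vanishes below that level.\<close>

locale recursion =
  fixes q r :: "nat \<Rightarrow> real \<Rightarrow> real" and s \<delta> :: real and n :: nat
  assumes \<delta>: "0 < \<delta>" "\<delta> \<le> 1" and s: "0 < s"
    and measurable_q [measurable]: "\<And>m. q m \<in> borel_measurable borel"
    and measurable_r [measurable]: "\<And>m. r m \<in> borel_measurable borel"
    and q_0: "\<And>z. 0 < z \<Longrightarrow> q 0 z = damp \<delta> z"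
    and r_0: "\<And>a. 0 < a \<Longrightarrow> r 0 a = a"
    and q_Suc: "\<And>m z. m < n \<Longrightarrow> 0 < z \<Longrightarrow> q (Suc m) z =
      (\<integral>x. q m (z / (1 + s\<^sup>2 * z) * exp (s * x - s\<^sup>2 / 2)) \<partial>std_gauss) / (1 + s\<^sup>2 * z)"
    and r_Suc: "\<And>m a. m < n \<Longrightarrow> s\<^sup>2 < a \<Longrightarrow> r (Suc m) a =
      (\<integral>x. r m ((a - s\<^sup>2) * exp (s * x - s\<^sup>2 / 2)) \<partial>std_gauss)"
    and r_bounds: "\<And>m a. 0 < a \<Longrightarrow> 0 \<le> r m a \<and> r m a \<le> a"
begin

lemma pos: "0 < z \<Longrightarrow> 0 < z / (1 + s\<^sup>2 * z)" "0 < z \<Longrightarrow> 1 \<le> 1 + s\<^sup>2 * z"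
  by (simp_all add: add_pos_nonneg)

lemma q_bounds: "m \<le> n \<Longrightarrow> 0 < z \<Longrightarrow> 0 \<le> q m z \<and> q m z \<le> 4 / \<delta>"
proof (induction m arbitrary: z)
  case 0
  then show ?case using q_0 damp_pos[OF \<delta>, of z] damp_le[OF \<delta>, of z] by simp
next
  case (Suc m)
  let ?w = "\<lambda>x. z / (1 + s\<^sup>2 * z) * exp (s * x - s\<^sup>2 / 2)"
  let ?I = "\<integral>x. q m (?w x) \<partial>std_gauss"
  have w: "0 < ?w x" for x
    using Suc.prems by (intro mult_pos_pos[OF pos(1)]) auto
  have b: "0 \<le> q m (?w x)" "q m (?w x) \<le> 4 / \<delta>" for x using Suc.IH[OF _ w] Suc.prems by auto
  have i: "integrable std_gauss (\<lambda>x. q m (?w x))"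
    using b by (intro std_gauss.integrable_const_bound[of _ "4 / \<delta>"] AE_I2) auto
  have "?I \<le> (\<integral>x. 4 / \<delta> \<partial>std_gauss)" using b i by (intro integral_mono) auto
  then have I: "0 \<le> ?I" "?I \<le> 4 / \<delta>"
    using b by (auto intro: integral_nonneg simp: std_gauss.prob_space[simplified])
  have "?I / (1 + s\<^sup>2 * z) \<le> ?I / 1" using I pos(2)[OF Suc.prems(2)]
    by (intro divide_left_mono mult_pos_pos) auto
  then show ?case using q_Suc[of m z] Suc.prems I pos(2)[of z] by auto
qed

lemma q_integrable:
  assumes "m \<le> n" "0 < z"
  shows "integrable std_gauss (\<lambda>x. q m (z * exp (s * x - s\<^sup>2 / 2)))"
  using q_bounds[OF assms(1)] assms
  by (intro std_gauss.integrable_const_bound[of _ "4 / \<delta>"] AE_I2) auto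

text \<open>The map from z to z / (1 + s^2 z) contracts distances and the log-normal factor has mean
  1, so the inherited constant does not grow. Only the prefactor 1 / (1 + s^2 z) adds to it: its
  Lipschitz constant s^2 times the bound 4 / \<delta>. Over n steps the total stays bounded.\<close>

lemma q_lipschitz: "m \<le> n \<Longrightarrow> 0 < x \<Longrightarrow> 0 < y \<Longrightarrow>
    \<bar>q m x - q m y\<bar> \<le> (48 / \<delta>\<^sup>2 + m * s\<^sup>2 * (4 / \<delta>)) * \<bar>x - y\<bar>"
proof (induction m arbitrary: x y)
  case 0
  then show ?case using q_0 damp_lipschitz[OF \<delta>, of x y] by simp
next
  case (Suc m)
  define e where "e v = exp (s * v - s\<^sup>2 / 2)" for v
  define L where "L = 48 / \<delta>\<^sup>2 + m * s\<^sup>2 * (4 / \<delta>)"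
  define p where "p v = 1 / (1 + s\<^sup>2 * v)" for v
  define I where "I v = (\<integral>x. q m (v * p v * e x) \<partial>std_gauss)" for v
  have L: "0 \<le> L" using \<delta> by (simp add: L_def)
  have d: "0 < 1 + s\<^sup>2 * x" "0 < 1 + s\<^sup>2 * y" using Suc.prems s by (simp_all add: add_pos_pos)
  have p: "0 < p x" "0 < p y" "p x \<le> 1" "p y \<le> 1" "0 < x * p x" "0 < y * p y"
    using d Suc.prems by (simp_all add: p_def divide_le_eq)
  have pd: "\<bar>p x - p y\<bar> \<le> s\<^sup>2 * \<bar>x - y\<bar>"
  proof -
    have "1 / D - 1 / E = (E - D) * (1 / D * (1 / E))" if "0 < D" "0 < E" for D E :: real
      using that by (simp add: field_simps)
    from this[OF d] have "p x - p y = (s\<^sup>2 * (y - x)) * (p x * p y)"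
      by (simp add: p_def right_diff_distrib)
    then have "\<bar>p x - p y\<bar> = \<bar>s\<^sup>2 * (y - x)\<bar> * (p x * p y)"
      using p by (simp add: abs_mult)
    also have "\<dots> \<le> \<bar>s\<^sup>2 * (y - x)\<bar> * (1 * 1)"
      using p by (intro mult_left_mono mult_mono) auto
    finally show ?thesis by (simp add: abs_mult abs_minus_commute)
  qed
  have xd: "\<bar>x * p x - y * p y\<bar> \<le> \<bar>x - y\<bar>"
  proof -
    have "x * p x - y * p y = (x - y) * (p x * p y)"
      using d by (simp add: p_def field_simps)
    then have "\<bar>x * p x - y * p y\<bar> = \<bar>x - y\<bar> * (p x * p y)"
      using p by (simp add: abs_mult)
    also have "\<dots> \<le> \<bar>x - y\<bar> * (1 * 1)"
      using p by (intro mult_left_mono mult_mono) auto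
    finally show ?thesis by simp
  qed
  have m: "m \<le> n" "m < n" using Suc.prems by auto
  have int: "integrable std_gauss (\<lambda>v. q m (x * p x * e v))"
      "integrable std_gauss (\<lambda>v. q m (y * p y * e v))"
    unfolding e_def using q_integrable[OF m(1)] p by auto
  have "I y \<le> (\<integral>x. 4 / \<delta> \<partial>std_gauss)" unfolding I_def
    using int(2) q_bounds[OF m(1)] p by (intro integral_mono) (auto simp: e_def)
  moreover have "0 \<le> I y" unfolding I_def
    using q_bounds[OF m(1)] p by (intro Bochner_Integration.integral_nonneg) (auto simp: e_def)
  ultimately have Iy: "\<bar>I y\<bar> \<le> 4 / \<delta>" by (simp add: std_gauss.prob_space[simplified])
  have "\<bar>I x - I y\<bar> = \<bar>\<integral>v. q m (x * p x * e v) - q m (y * p y * e v) \<partial>std_gauss\<bar>"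
    using int by (simp add: I_def)
  also have "\<dots> \<le> (\<integral>v. \<bar>q m (x * p x * e v) - q m (y * p y * e v)\<bar> \<partial>std_gauss)"
    by (rule integral_abs_bound)
  also have "\<dots> \<le> (\<integral>v. L * \<bar>x - y\<bar> * e v \<partial>std_gauss)"
  proof (rule integral_mono)
    fix v
    have e: "0 < e v" by (simp add: e_def)
    then have "\<bar>q m (x * p x * e v) - q m (y * p y * e v)\<bar> \<le> L * \<bar>x * p x * e v - y * p y * e v\<bar>"
      unfolding L_def using p by (intro Suc.IH m) auto
    also have "\<bar>x * p x * e v - y * p y * e v\<bar> = \<bar>x * p x - y * p y\<bar> * e v"
      using e by (simp add: abs_mult flip: left_diff_distrib)
    also have "L * (\<bar>x * p x - y * p y\<bar> * e v) \<le> L * (\<bar>x - y\<bar> * e v)"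
      using xd e L by (intro mult_left_mono mult_right_mono) auto
    finally show "\<bar>q m (x * p x * e v) - q m (y * p y * e v)\<bar> \<le> L * \<bar>x - y\<bar> * e v"
      by (simp add: mult.assoc)
  qed (use int integrable_lognormal[of s] in \<open>auto simp: e_def\<close>)
  also have "\<dots> = L * \<bar>x - y\<bar>" by (simp add: e_def)
  finally have Id: "\<bar>I x - I y\<bar> \<le> L * \<bar>x - y\<bar>" .
  have "q (Suc m) x - q (Suc m) y = p x * (I x - I y) + (p x - p y) * I y"
    using q_Suc[OF m(2)] Suc.prems by (simp add: I_def p_def e_def algebra_simps)
  also have "\<bar>\<dots>\<bar> \<le> \<bar>p x * (I x - I y)\<bar> + \<bar>(p x - p y) * I y\<bar>"
    by (rule abs_triangle_ineq)
  also have "\<dots> \<le> 1 * (L * \<bar>x - y\<bar>) + (s\<^sup>2 * \<bar>x - y\<bar>) * (4 / \<delta>)"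
    unfolding abs_mult using p Id pd Iy by (intro add_mono mult_mono) auto
  also have "\<dots> = (48 / \<delta>\<^sup>2 + Suc m * s\<^sup>2 * (4 / \<delta>)) * \<bar>x - y\<bar>"
    by (simp add: L_def algebra_simps)
  finally show ?case .
qed

text \<open>In one step the divisor of z and the killing prefactor cancel, and the inverse
  log-normal variable contributes its mean exp (s^2).\<close>

lemma q_decay: "m \<le> n \<Longrightarrow> 0 < z \<Longrightarrow> q m z \<le> exp (m * s\<^sup>2) / (\<delta> * z)"
proof (induction m arbitrary: z)
  case 0
  then show ?case using q_0 damp_le_inverse[OF \<delta>, of z] by simp
next
  case (Suc m)
  let ?e = "\<lambda>x. exp (s * x - s\<^sup>2 / 2)"
  let ?k = "z / (1 + s\<^sup>2 * z)"
  have m: "m \<le> n" "m < n" using Suc.prems by auto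
  have k: "0 < ?k" using pos Suc.prems by simp
  have "(\<integral>x. q m (?k * ?e x) \<partial>std_gauss) \<le> (\<integral>x. exp (m * s\<^sup>2) / (\<delta> * ?k) * (1 / ?e x) \<partial>std_gauss)"
  proof (rule integral_mono)
    show "integrable std_gauss (\<lambda>x. q m (?k * ?e x))" using q_integrable[OF m(1) k] .
    show "integrable std_gauss (\<lambda>x. exp (m * s\<^sup>2) / (\<delta> * ?k) * (1 / ?e x))"
      by (intro integrable_mult_right integral_lognormal_inverse)
    show "q m (?k * ?e x) \<le> exp (m * s\<^sup>2) / (\<delta> * ?k) * (1 / ?e x)" for x
    proof -
      have "q m (?k * ?e x) \<le> exp (m * s\<^sup>2) / (\<delta> * (?k * ?e x))"
        by (intro Suc.IH m mult_pos_pos[OF k]) auto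
      also have "\<dots> = exp (m * s\<^sup>2) / (\<delta> * ?k) * (1 / ?e x)"
        by (simp only: times_divide_times_eq mult_1_right mult.assoc)
      finally show ?thesis .
    qed
  qed
  also have "\<dots> = exp (m * s\<^sup>2) / (\<delta> * ?k) * exp (s\<^sup>2)"
    by (simp only: integral_mult_right_zero integral_lognormal_inverse)
  also have "\<dots> = exp (Suc m * s\<^sup>2) / (\<delta> * ?k)"
    by (simp add: algebra_simps exp_add)
  finally have "q (Suc m) z \<le> exp (Suc m * s\<^sup>2) / (\<delta> * ?k) / (1 + s\<^sup>2 * z)"
    unfolding q_Suc[OF m(2) Suc.prems(2)] using pos(2)[OF Suc.prems(2)]
    by (intro divide_right_mono) auto
  also have "\<dots> = exp (Suc m * s\<^sup>2) / (\<delta> * z)"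
  proof -
    have "E / (\<delta> * (z / D)) / D = E / (\<delta> * z)" if "1 \<le> D" for D E :: real using that by simp
    then show ?thesis using pos(2)[OF Suc.prems(2)] by blast
  qed
  finally show ?case .
qed

text \<open>Conjugation by psi at the discrete level. Size biasing removes the factor X of psi and
  inverts the log-normal variable, so 1/X becomes z / (1 - u) times a log-normal variable; the
  factor 1 - u comes from a - s^2 = a (1 - u).\<close>

lemma tilted_step:
  fixes \<phi> :: "real \<Rightarrow> real"
  assumes [measurable]: "\<phi> \<in> borel_measurable borel"
    and a: "0 < a" "s\<^sup>2 < a"
  defines "u \<equiv> s\<^sup>2 * (1 / a)" and "X \<equiv> \<lambda>x. (a - s\<^sup>2) * exp (s * x - s\<^sup>2 / 2)"
  shows "(\<integral>x. X x * exp (- 2 / X x) * \<phi> (1 / X x) \<partial>std_gauss) = a * exp (- 2 / a) * ((1 - u) *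
    (\<integral>x. exp (2 * (1 / a) - 2 * (1 / a / (1 - u) * exp (s * x - s\<^sup>2 / 2))) *
      \<phi> (1 / a / (1 - u) * exp (s * x - s\<^sup>2 / 2)) \<partial>std_gauss))"
proof -
  define b where "b = a - s\<^sup>2"
  have b: "0 < b" "b = a * (1 - u)" "1 / a / (1 - u) = 1 / b"
    using a by (simp_all add: b_def u_def field_simps)
  define F where "F y = exp (- 2 / (b * y)) * \<phi> (1 / (b * y))" for y
  have [measurable]: "F \<in> borel_measurable borel" unfolding F_def[abs_def] by measurable
  have F: "F (1 / y) = exp (- 2 / a) * (exp (2 * (1 / a) - 2 * (1 / b * y)) * \<phi> (1 / b * y))"
    for y
    by (simp add: F_def flip: exp_add)
  have "(\<integral>x. X x * exp (- 2 / X x) * \<phi> (1 / X x) \<partial>std_gauss) =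
      (\<integral>x. b * (exp (s * x - s\<^sup>2 / 2) * F (exp (s * x - s\<^sup>2 / 2))) \<partial>std_gauss)"
    by (simp add: X_def F_def b_def mult_ac)
  also have "\<dots> = b * (\<integral>x. F (1 / exp (s * x - s\<^sup>2 / 2)) \<partial>std_gauss)"
    by (subst lognormal_size_bias[symmetric]) simp_all
  also have "\<dots> = a * exp (- 2 / a) * ((1 - u) *
    (\<integral>x. exp (2 * (1 / a) - 2 * (1 / b * exp (s * x - s\<^sup>2 / 2))) *
      \<phi> (1 / b * exp (s * x - s\<^sup>2 / 2)) \<partial>std_gauss))"
    unfolding F integral_mult_right_zero b(2) by (simp only: mult_ac)
  finally show ?thesis unfolding b(3) .
qed

text \<open>
  The error allowed for \<^term>\<open>r\<close> is a sum of a constant and a multiple of the one-step supersolution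
  \<^term>\<open>a * exp (- 2 / a)\<close>. For \<^term>\<open>a \<le> \<epsilon>\<close>, where the one-step estimate is not uniform, both sides are small
  for trivial reasons, so no estimate for large arguments of \<^term>\<open>q m\<close> beyond its decay is needed.
\<close>
lemma comparison:
  assumes \<epsilon>: "0 < \<epsilon>" "\<epsilon> \<le> 1" "s \<le> \<epsilon> / 2" and \<beta>: "\<epsilon> \<le> \<beta>" "\<And>z. 0 < z \<Longrightarrow> \<delta> * damp \<delta> z \<le> \<beta>"
    and T: "n * s\<^sup>2 \<le> T"
  defines "H \<equiv> step_const (1 / \<epsilon>) * (4 / \<delta> + (48 / \<delta>\<^sup>2 + T * (4 / \<delta>)) + 1)"
    and "\<psi> \<equiv> \<lambda>a. a * exp (- 2 / a)"
  shows "m \<le> n \<Longrightarrow> 0 < a \<Longrightarrow> \<bar>r m a - \<psi> a * q m (1 / a)\<bar> \<le>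
    \<beta> + ((exp T * \<epsilon> / \<delta> + 1) * (1 + H * s ^ 3) ^ m - 1) * \<psi> a"
proof (induction m arbitrary: a)
  case 0
  have "0 \<le> exp T * \<epsilon> / \<delta> * \<psi> a" using \<epsilon> \<delta> 0 by (simp add: \<psi>_def)
  moreover have "0 \<le> \<delta> * damp \<delta> (1 / a)" using damp_pos[OF \<delta>, of "1 / a"] 0 \<delta> by simp
  ultimately show ?case
    using 0 q_0[of "1 / a"] r_0[of a] damp_payoff[OF \<delta>, of a] \<beta>(2)[of "1 / a"]
    by (simp add: \<psi>_def)
next
  case (Suc m)
  have a: "0 < a" and m: "m < n" "m \<le> n" using Suc.prems by auto
  \<comment> \<open>With G = \<open>H * s ^ 3\<close> the coefficient evolves by e' = e (1 + G) + G:
    old errors are amplified along psi and one new error is added. Hence e + 1 is multiplied by 1 +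
    G, which explains the closed form with - 1.\<close>
  define e where "e = (exp T * \<epsilon> / \<delta> + 1) * (1 + H * s ^ 3) ^ m - 1"
  have sc: "0 \<le> step_const (1 / \<epsilon>)" using \<epsilon> by (intro step_const_nonneg) auto
  have T0: "0 \<le> T" using T by (meson order_trans mult_nonneg_nonneg of_nat_0_le_iff zero_le_power2)
  have H: "0 \<le> H" unfolding H_def using sc T0 \<delta> by simp
  have Hs: "0 \<le> H * s ^ 3" using H s by simp
  have \<psi>: "0 < \<psi> v" "\<psi> v \<le> v" if "0 < v" for v using that by (simp_all add: \<psi>_def)
  \<comment> \<open>The coefficient never falls below its starting value, which is what the region a
    <= \<epsilon> demands at every step.\<close>
  have e_ge: "exp T * \<epsilon> / \<delta> \<le> (exp T * \<epsilon> / \<delta> + 1) * (1 + H * s ^ 3) ^ k - 1" for k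
  proof -
    have "(exp T * \<epsilon> / \<delta> + 1) * 1 \<le> (exp T * \<epsilon> / \<delta> + 1) * (1 + H * s ^ 3) ^ k"
      using Hs \<epsilon> \<delta> by (intro mult_left_mono one_le_power) auto
    then show ?thesis by simp
  qed
  have "0 \<le> exp T * \<epsilon> / \<delta>" using \<epsilon> \<delta> by simp
  then have e0: "0 \<le> e" using e_ge[of m] unfolding e_def by linarith
  show ?case
  proof (cases "a \<le> \<epsilon>")
    case True
    \<comment> \<open>Without any cancellation: both quantities are nonnegative, the put is at most
      a <= \<epsilon> <= \<beta>, and the decay of \<open>q\<close> keeps the other one below the
      psi part of the allowance.\<close>
    have "q (Suc m) (1 / a) \<le> exp (real (Suc m) * s\<^sup>2) / (\<delta> * (1 / a))"
      using Suc.prems by (intro q_decay) auto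
    also have "\<dots> \<le> exp T / (\<delta> * (1 / \<epsilon>))"
    proof (rule frac_le)
      have "real (Suc m) * s\<^sup>2 \<le> n * s\<^sup>2" using Suc.prems by (intro mult_right_mono) auto
      then show "exp (real (Suc m) * s\<^sup>2) \<le> exp T" using T by simp
      show "\<delta> * (1 / \<epsilon>) \<le> \<delta> * (1 / a)" using True a \<delta> by (intro mult_left_mono frac_le) auto
    qed (use \<delta> \<epsilon> in auto)
    finally have "q (Suc m) (1 / a) \<le> (exp T * \<epsilon> / \<delta> + 1) * (1 + H * s ^ 3) ^ Suc m - 1"
      using e_ge[of "Suc m"] by simp
    then have "\<psi> a * q (Suc m) (1 / a) \<le>
        \<psi> a * ((exp T * \<epsilon> / \<delta> + 1) * (1 + H * s ^ 3) ^ Suc m - 1)"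
      using \<psi>(1)[OF a] by (intro mult_left_mono) auto
    moreover have "0 \<le> \<psi> a * q (Suc m) (1 / a)"
      using \<psi>(1)[OF a] q_bounds[of "Suc m" "1 / a"] Suc.prems by simp
    ultimately show ?thesis
      using r_bounds[OF a, of "Suc m"] True \<beta>(1) unfolding mult.commute[of _ "\<psi> a"] by linarith
  next
    case False
    let ?z = "1 / a" and ?N = "1 / \<epsilon>"
    have "s * s \<le> (\<epsilon> / 2) * 1" using s \<epsilon> by (intro mult_mono) auto
    then have sa: "s\<^sup>2 < a" using False \<epsilon> by (simp add: power2_eq_square)
    \<comment> \<open>Outside the cut, a > \<epsilon> gives 1/a <= 1/\<epsilon>, and s <=
      \<epsilon>/2 gives s * (1/\<epsilon>) <= 1/2.\<close>
    interpret tilt s ?z ?N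
      using a s \<epsilon> False by unfold_locales (auto simp: field_simps)
    have u: "u = s\<^sup>2 * ?z" by (rule u_def)
    define X where "X x = (a - s\<^sup>2) * exp (s * x - s\<^sup>2 / 2)" for x
    have X: "0 < X x" for x using sa by (simp add: X_def)
    have [measurable]: "X \<in> borel_measurable borel" "\<psi> \<in> borel_measurable borel"
      unfolding X_def[abs_def] \<psi>_def by measurable
    have iX: "integrable std_gauss X"
      unfolding X_def[abs_def] by (intro integrable_mult_right integrable_lognormal)
    have ir: "integrable std_gauss (\<lambda>x. r m (X x))"
    proof (rule Bochner_Integration.integrable_bound[OF iX])
      show "AE x in std_gauss. norm (r m (X x)) \<le> norm (X x)"
        using r_bounds[OF X] X by (intro AE_I2) (simp add: less_imp_le)
    qed simp
    have i\<psi>: "integrable std_gauss (\<lambda>x. \<psi> (X x))"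
    proof (rule Bochner_Integration.integrable_bound[OF iX])
      show "AE x in std_gauss. norm (\<psi> (X x)) \<le> norm (X x)"
        using \<psi>[OF X] X by (intro AE_I2) (simp add: less_imp_le)
    qed simp
    have i\<psi>q: "integrable std_gauss (\<lambda>x. \<psi> (X x) * q m (1 / X x))"
    proof (rule Bochner_Integration.integrable_bound)
      show "integrable std_gauss (\<lambda>x. \<psi> (X x) * (4 / \<delta>))" using i\<psi> by simp
      show "AE x in std_gauss. norm (\<psi> (X x) * q m (1 / X x)) \<le> norm (\<psi> (X x) * (4 / \<delta>))"
      proof (intro AE_I2)
        fix x
        have "\<bar>\<psi> (X x)\<bar> * \<bar>q m (1 / X x)\<bar> \<le> \<bar>\<psi> (X x)\<bar> * \<bar>4 / \<delta>\<bar>"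
          using q_bounds[OF m(2), of "1 / X x"] X \<delta> by (intro mult_left_mono) auto
        then show "norm (\<psi> (X x) * q m (1 / X x)) \<le> norm (\<psi> (X x) * (4 / \<delta>))"
          by (simp only: real_norm_def abs_mult)
      qed
    qed simp
    define C where "C = 4 / \<delta>"
    define L where "L = 48 / \<delta>\<^sup>2 + T * (4 / \<delta>)"
    have CL: "0 \<le> C" "0 \<le> L" using \<delta> T0 by (simp_all add: C_def L_def)
    have qb: "\<bar>q m x\<bar> \<le> C" if "0 < x" for x using q_bounds[OF m(2) that] by (simp add: C_def)
    have ql: "\<bar>q m x - q m y\<bar> \<le> L * \<bar>x - y\<bar>" if "0 < x" "0 < y" for x y
    proof -
      have "real m * s\<^sup>2 \<le> n * s\<^sup>2" using m by (intro mult_right_mono) auto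
      then have "m * s\<^sup>2 * (4 / \<delta>) \<le> T * (4 / \<delta>)" using T \<delta> by (intro mult_right_mono) auto
      then have "(48 / \<delta>\<^sup>2 + m * s\<^sup>2 * (4 / \<delta>)) * \<bar>x - y\<bar> \<le> L * \<bar>x - y\<bar>"
        unfolding L_def by (intro mult_right_mono) auto
      then show ?thesis using q_lipschitz[OF m(2) that] by linarith
    qed
    have HCL: "H = step_const ?N * (C + L + 1)" by (simp add: H_def C_def L_def)
    have step_q: "\<bar>(\<integral>x. \<psi> (X x) * q m (1 / X x) \<partial>std_gauss) - \<psi> a * q (Suc m) ?z\<bar> \<le>
        \<psi> a * (H * s ^ 3)"
    proof -
      have "\<bar>(\<integral>x. \<psi> (X x) * q m (1 / X x) \<partial>std_gauss) - \<psi> a * q (Suc m) ?z\<bar> \<le>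
          \<psi> a * (step_const ?N * s ^ 3 * (C + L))"
      proof -
        define I where "I = (1 - u) * (\<integral>x. exp (2 * ?z - 2 * (?z / (1 - u) * exp (s * x - s\<^sup>2 / 2))) *
            q m (?z / (1 - u) * exp (s * x - s\<^sup>2 / 2)) \<partial>std_gauss)"
        have "\<bar>I - (\<integral>x. q m (?z / (1 + u) * exp (s * x - s\<^sup>2 / 2)) \<partial>std_gauss) / (1 + u)\<bar> \<le>
            step_const ?N * s ^ 3 * (C + L)"
          unfolding I_def by (rule one_step(2)[OF measurable_q[of m]]) (use qb ql in auto)
        then have "\<bar>I - q (Suc m) ?z\<bar> \<le> step_const ?N * s ^ 3 * (C + L)"
          unfolding q_Suc[OF m(1) z(1)] u .
        moreover have "(\<integral>x. \<psi> (X x) * q m (1 / X x) \<partial>std_gauss) = \<psi> a * I"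
          unfolding X_def \<psi>_def tilted_step[OF measurable_q a sa] I_def u ..
        moreover have "\<bar>\<psi> a * I - \<psi> a * q (Suc m) ?z\<bar> = \<psi> a * \<bar>I - q (Suc m) ?z\<bar>"
          unfolding right_diff_distrib[symmetric] abs_mult using \<psi>(1)[OF a] by simp
        ultimately show ?thesis
          using \<psi>(1)[OF a] by (simp add: mult_left_mono)
      qed
      also have "\<dots> \<le> \<psi> a * (H * s ^ 3)"
      proof -
        have "0 \<le> step_const ?N * s ^ 3" using sc s by simp
        then have "step_const ?N * s ^ 3 * (C + L) \<le> step_const ?N * s ^ 3 * (C + L + 1)"
          by (intro mult_left_mono) auto
        then have "step_const ?N * s ^ 3 * (C + L) \<le> H * s ^ 3"
          unfolding HCL by (simp only: mult_ac)
        then show ?thesis using \<psi>(1)[OF a] by (intro mult_left_mono) auto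
      qed
      finally show ?thesis .
    qed
    \<comment> \<open>The one-step estimate for the constant function 1, with C = 1 and L = 0: the
      put kernel maps psi below itself up to the factor 1 + H s^3. The summand 1 in \<open>H\<close>
      makes room for this use.\<close>
    have step_1: "(\<integral>x. \<psi> (X x) \<partial>std_gauss) \<le> \<psi> a * (1 + H * s ^ 3)"
    proof -
      have gen: "A \<le> 1 + D" if "\<bar>A - B\<bar> \<le> K * (1 + 0)" "B \<le> 1" "K * 1 \<le> E" "E = D"
        for A B D E K :: real
        using that by simp
      have "\<bar>(1 - u) * (\<integral>x. exp (2 * ?z - 2 * (?z / (1 - u) * exp (s * x - s\<^sup>2 / 2))) * 1 \<partial>std_gauss) -
          (\<integral>x. 1 \<partial>std_gauss) / (1 + u)\<bar> \<le> step_const ?N * s ^ 3 * (1 + 0)"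
        by (rule one_step(2)[of "\<lambda>_. 1"]) auto
      moreover have "(\<integral>x. 1 \<partial>std_gauss) / (1 + u) \<le> 1"
        using u_bounds by (simp add: std_gauss.prob_space[simplified])
      moreover have "step_const ?N * s ^ 3 * 1 \<le> step_const ?N * s ^ 3 * (C + L + 1)"
        using sc s CL by (intro mult_left_mono) auto
      moreover have "step_const ?N * s ^ 3 * (C + L + 1) = H * s ^ 3"
        unfolding HCL by (simp only: mult_ac)
      ultimately have "(1 - u) *
          (\<integral>x. exp (2 * ?z - 2 * (?z / (1 - u) * exp (s * x - s\<^sup>2 / 2))) * 1 \<partial>std_gauss) \<le> 1 + H * s ^ 3"
        by (rule gen)
      from mult_left_mono[OF this less_imp_le[OF \<psi>(1)[OF a]]]
      show ?thesis
        using tilted_step[of "\<lambda>_. 1" a] a sa unfolding X_def \<psi>_def u by simp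
    qed
    have "r (Suc m) a = (\<integral>x. r m (X x) \<partial>std_gauss)"
      unfolding X_def using m(1) sa by (rule r_Suc)
    then have "\<bar>r (Suc m) a - (\<integral>x. \<psi> (X x) * q m (1 / X x) \<partial>std_gauss)\<bar> =
        \<bar>\<integral>x. r m (X x) - \<psi> (X x) * q m (1 / X x) \<partial>std_gauss\<bar>"
      using ir i\<psi>q by simp
    also have "\<dots> \<le> (\<integral>x. \<bar>r m (X x) - \<psi> (X x) * q m (1 / X x)\<bar> \<partial>std_gauss)"
      by (rule integral_abs_bound)
    \<comment> \<open>The constant \<beta> passes through every step unchanged, since the put kernel
      has total mass 1.\<close>
    also have "\<dots> \<le> (\<integral>x. \<beta> + e * \<psi> (X x) \<partial>std_gauss)"
      using ir i\<psi>q i\<psi> Suc.IH[OF m(2) X] by (intro integral_mono) (auto simp: e_def)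
    also have "\<dots> = \<beta> + e * (\<integral>x. \<psi> (X x) \<partial>std_gauss)"
      using i\<psi> by (simp add: std_gauss.prob_space[simplified])
    also have "\<dots> \<le> \<beta> + e * (\<psi> a * (1 + H * s ^ 3))"
      using step_1 e0 by (intro add_left_mono mult_left_mono)
    finally have "\<bar>r (Suc m) a - \<psi> a * q (Suc m) ?z\<bar> \<le>
        \<beta> + e * (\<psi> a * (1 + H * s ^ 3)) + \<psi> a * (H * s ^ 3)"
      using step_q by linarith
    also have "\<dots> = \<beta> + ((exp T * \<epsilon> / \<delta> + 1) * (1 + H * s ^ 3) ^ Suc m - 1) * \<psi> a"
    proof -
      have "\<beta> + (A * D - 1) * (E * (1 + G)) + E * G = \<beta> + (A * ((1 + G) * D) - 1) * E" for A D E G :: real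
        by (simp add: algebra_simps)
      then show ?thesis unfolding e_def power_Suc .
    qed
    finally show ?thesis .
  qed
qed

end

section \<open>First-step analysis of the discretised exponential functional\<close>

lemma distr_scaled_std_gauss:
  assumes "0 < s"
  shows "distr std_gauss borel (\<lambda>x. s * x) = density lborel (normal_density 0 s)"
proof -
  have "distributed std_gauss lborel (\<lambda>x. x) std_normal_density"
    by (auto simp: distributed_def std_gauss_def distr_id2)
  from std_gauss.normal_density_affine[OF this, of s 0] assms
  have "distributed std_gauss lborel (\<lambda>x. s * x) (normal_density 0 s)" by simp
  then have "distr std_gauss lborel (\<lambda>x. s * x) = density lborel (normal_density 0 s)"
    by (rule distributed_distr_eq_density)
  then show ?thesis by (simp cong: distr_cong)
qed

text \<open>Independence makes the joint law a product measure, and Fubini then allows X to be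
  frozen.\<close>

lemma (in prob_space) expectation_indep:
  fixes F :: "'b \<times> 'b \<Rightarrow> real"
  assumes indep: "indep_var S X T W" and F [measurable]: "F \<in> borel_measurable (S \<Otimes>\<^sub>M T)"
    and int: "integrable M (\<lambda>\<omega>. F (X \<omega>, W \<omega>))"
  shows "(\<integral>\<omega>. F (X \<omega>, W \<omega>) \<partial>M) = (\<integral>\<omega>'. (\<integral>\<omega>. F (X \<omega>', W \<omega>) \<partial>M) \<partial>M)"
proof -
  note [measurable] = indep_var_rv1[OF indep] indep_var_rv2[OF indep]
  have eq: "distr M S X \<Otimes>\<^sub>M distr M T W = distr M (S \<Otimes>\<^sub>M T) (\<lambda>x. (X x, W x))"
    using indep by (simp add: indep_var_distribution_eq)
  interpret X: prob_space "distr M S X" by (rule prob_space_distr) simp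
  interpret W: prob_space "distr M T W" by (rule prob_space_distr) simp
  interpret pair_sigma_finite "distr M S X" "distr M T W" ..
  have "integrable (distr M S X \<Otimes>\<^sub>M distr M T W) F"
    unfolding eq using int by (subst integrable_distr_eq) auto
  from integral_fst'[OF this]
  have "(\<integral>\<omega>. F (X \<omega>, W \<omega>) \<partial>M) = (\<integral>x. (\<integral>y. F (x, y) \<partial>distr M T W) \<partial>distr M S X)"
    unfolding eq by (simp add: integral_distr)
  also have "\<dots> = (\<integral>\<omega>'. (\<integral>y. F (X \<omega>', y) \<partial>distr M T W) \<partial>M)"
    by (subst integral_distr) auto
  also have "\<dots> = (\<integral>\<omega>'. (\<integral>\<omega>. F (X \<omega>', W \<omega>) \<partial>M) \<partial>M)"
    by (intro Bochner_Integration.integral_cong refl integral_distr) auto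
  finally show ?thesis .
qed

text \<open>
  \<^term>\<open>end_value h m k \<xi>\<close> and \<^term>\<open>left_sum h m k \<xi>\<close> are the end point and the left Riemann sum of the
  exponential martingale restarted at time \<^term>\<open>k * h\<close> and run for \<^term>\<open>m\<close> steps with increments \<^term>\<open>\<xi>\<close>.
\<close>
definition end_value :: "real \<Rightarrow> nat \<Rightarrow> nat \<Rightarrow> (nat \<Rightarrow> real) \<Rightarrow> real" where
  "end_value h m k \<xi> = exp ((\<Sum>i<m. \<xi> (k + i)) - real m * h / 2)"

definition left_sum :: "real \<Rightarrow> nat \<Rightarrow> nat \<Rightarrow> (nat \<Rightarrow> real) \<Rightarrow> real" where
  "left_sum h m k \<xi> = h * (\<Sum>j<m. exp ((\<Sum>i<j. \<xi> (k + i)) - real j * h / 2))"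

lemma end_value_Suc: "end_value h (Suc m) k \<xi> = exp (\<xi> k - h / 2) * end_value h m (Suc k) \<xi>"
  unfolding end_value_def sum.lessThan_Suc_shift by (simp add: algebra_simps flip: exp_add)

text \<open>The left endpoint rule makes the first summand the deterministic \<open>h\<close>, while
  all later ones carry the first exponential factor. This is the source of a - s^2 and of 1 + s^2 z
  in the two recursions.\<close>

lemma left_sum_Suc: "left_sum h (Suc m) k \<xi> = h + exp (\<xi> k - h / 2) * left_sum h m (Suc k) \<xi>"
proof -
  have "left_sum h (Suc m) k \<xi> =
      h + h * (\<Sum>j<m. exp ((\<Sum>i<Suc j. \<xi> (k + i)) - real (Suc j) * h / 2))"
    unfolding left_sum_def sum.lessThan_Suc_shift[of "\<lambda>j. exp ((\<Sum>i<j. \<xi> (k + i)) - real j * h / 2)"]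
    by (simp add: algebra_simps)
  also have "(\<Sum>j<m. exp ((\<Sum>i<Suc j. \<xi> (k + i)) - real (Suc j) * h / 2)) =
      (\<Sum>j<m. exp (\<xi> k - h / 2) * exp ((\<Sum>i<j. \<xi> (Suc k + i)) - real j * h / 2))"
    unfolding sum.lessThan_Suc_shift by (intro sum.cong refl) (simp add: field_simps flip: exp_add)
  finally show ?thesis by (simp add: left_sum_def mult_ac flip: sum_distrib_left)
qed

lemma end_value_cong:
  "(\<And>i. i < m \<Longrightarrow> \<xi> (k + i) = \<zeta> (k + i)) \<Longrightarrow> end_value h m k \<xi> = end_value h m k \<zeta>"
  by (simp add: end_value_def)

lemma left_sum_cong:
  "(\<And>i. i < m \<Longrightarrow> \<xi> (k + i) = \<zeta> (k + i)) \<Longrightarrow> left_sum h m k \<xi> = left_sum h m k \<zeta>"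
  by (simp add: left_sum_def)

lemma left_sum_nonneg: "0 \<le> h \<Longrightarrow> 0 \<le> left_sum h m k \<xi>"
  by (simp add: left_sum_def sum_nonneg)

section \<open>The recursions for the Riemann sums of Brownian motion\<close>

context standard_brownian_motion
begin

definition increment :: "real \<Rightarrow> 'w \<Rightarrow> nat \<Rightarrow> real" where
  "increment h \<omega> i = B (real (Suc i) * h) \<omega> - B (real i * h) \<omega>"

lemma measurable_increment [measurable]:
  "0 \<le> h \<Longrightarrow> (\<lambda>\<omega>. increment h \<omega> i) \<in> borel_measurable P"
  unfolding increment_def using random_variable_B by (intro borel_measurable_diff) auto

lemma measurable_end_value [measurable]:
  "0 \<le> h \<Longrightarrow> (\<lambda>\<omega>. end_value h m k (increment h \<omega>)) \<in> borel_measurable P"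
  unfolding end_value_def by measurable

lemma measurable_left_sum [measurable]:
  "0 \<le> h \<Longrightarrow> (\<lambda>\<omega>. left_sum h m k (increment h \<omega>)) \<in> borel_measurable P"
  unfolding left_sum_def by measurable

lemma end_value_increment:
  "end_value h m 0 (increment h \<omega>) = exp (B (real m * h) \<omega> - B 0 \<omega> - real m * h / 2)"
  unfolding end_value_def increment_def
  using sum_lessThan_telescope[of "\<lambda>i. B (real i * h) \<omega>" m] by simp

lemma left_sum_increment:
  "left_sum h m 0 (increment h \<omega>) = h * (\<Sum>j<m. exp (B (real j * h) \<omega> - B 0 \<omega> - real j * h / 2))"
  unfolding left_sum_def increment_def
  using sum_lessThan_telescope[of "\<lambda>i. B (real i * h) \<omega>"] by simp

lemma distr_increment:
  assumes "0 < s"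
  shows "distr P borel (\<lambda>\<omega>. increment (s\<^sup>2) \<omega> k) = distr std_gauss borel (\<lambda>x. s * x)"
proof -
  have "real k * s\<^sup>2 < real (Suc k) * s\<^sup>2" using assms by (simp add: algebra_simps)
  then have "distributed P lborel (\<lambda>\<omega>. B (real (Suc k) * s\<^sup>2) \<omega> - B (real k * s\<^sup>2) \<omega>)
      (normal_density 0 (sqrt (real (Suc k) * s\<^sup>2 - real k * s\<^sup>2)))"
    by (intro gaussian_increments) auto
  moreover have "sqrt (real (Suc k) * s\<^sup>2 - real k * s\<^sup>2) = s" using assms by (simp add: algebra_simps)
  ultimately have "distr P lborel (\<lambda>\<omega>. increment (s\<^sup>2) \<omega> k) = density lborel (normal_density 0 s)"
    unfolding increment_def by (intro distributed_distr_eq_density) simp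
  then show ?thesis
    using distr_scaled_std_gauss[OF assms] by (simp cong: distr_cong)
qed

text \<open>Markov property at the first grid point: the restarted end value and left sum read only
  increments from \<open>Suc k\<close> on, which are independent of increment \<open>k\<close>, and
  the latter has the law of \<open>s * x\<close>.\<close>

lemma first_step:
  fixes F :: "real \<Rightarrow> real \<Rightarrow> real \<Rightarrow> real"
  assumes s: "0 < s" and F [measurable]: "(\<lambda>(e, v, y). F e v y) \<in> borel_measurable borel"
  defines "h \<equiv> s\<^sup>2"
  assumes int: "integrable P (\<lambda>\<omega>. F (exp (increment h \<omega> k - h / 2))
    (end_value h m (Suc k) (increment h \<omega>)) (left_sum h m (Suc k) (increment h \<omega>)))"
  shows "(\<integral>\<omega>. F (exp (increment h \<omega> k - h / 2)) (end_value h m (Suc k) (increment h \<omega>))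
      (left_sum h m (Suc k) (increment h \<omega>)) \<partial>P) =
    (\<integral>x. (\<integral>\<omega>. F (exp (s * x - s\<^sup>2 / 2)) (end_value h m (Suc k) (increment h \<omega>))
      (left_sum h m (Suc k) (increment h \<omega>)) \<partial>P) \<partial>std_gauss)"
proof -
  have h: "0 < h" "0 \<le> h" using s by (simp_all add: h_def)
  note [measurable] = measurable_increment[OF h(2)] measurable_end_value[OF h(2)] measurable_left_sum[OF h(2)]
  let ?n = "Suc k + m" and ?J = "{Suc k..<Suc k + m}"
  let ?X = "\<lambda>\<omega>. restrict (\<lambda>i. increment h \<omega> i) {k}"
  let ?Y = "\<lambda>\<omega>. restrict (\<lambda>i. increment h \<omega> i) ?J"
  have "indep_vars (\<lambda>_. borel) (\<lambda>i \<omega>. B (real (Suc i) * h) \<omega> - B (real i * h) \<omega>) {..<?n}"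
    using h by (intro independent_increments) (auto simp: strict_mono_on_def)
  then have "indep_vars (\<lambda>_. borel) (\<lambda>i \<omega>. increment h \<omega> i) {..<?n}"
    by (simp add: increment_def)
  then have ind: "indep_var (PiM {k} (\<lambda>_. borel)) ?X (PiM ?J (\<lambda>_. borel)) ?Y"
    by (rule indep_var_restrict) auto
  have F': "(\<lambda>p. F (f p) (g p) (j p)) \<in> borel_measurable N"
    if [measurable]: "f \<in> borel_measurable N" "g \<in> borel_measurable N" "j \<in> borel_measurable N"
    for f g j :: "'z \<Rightarrow> real" and N
    using measurable_compose[of "\<lambda>p. (f p, g p, j p)" N borel, OF _ F] by simp
  define G where "G p = F (exp (fst p k - h / 2)) (end_value h m (Suc k) (snd p)) (left_sum h m (Suc k) (snd p))"
    for p :: "(nat \<Rightarrow> real) \<times> (nat \<Rightarrow> real)"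
  have c: "(\<lambda>p. snd p (Suc k + i)) \<in> borel_measurable
      (PiM {k} (\<lambda>_. borel :: real measure) \<Otimes>\<^sub>M PiM ?J (\<lambda>_. borel :: real measure))" if "i < m" for i
    using that by (intro measurable_compose[OF measurable_snd measurable_component_singleton]) auto
  have meas: "G \<in> borel_measurable (PiM {k} (\<lambda>_. borel) \<Otimes>\<^sub>M PiM ?J (\<lambda>_. borel))"
    unfolding G_def[abs_def]
  proof (rule F')
    show "(\<lambda>p. end_value h m (Suc k) (snd p)) \<in>
        borel_measurable (PiM {k} (\<lambda>_. borel) \<Otimes>\<^sub>M PiM ?J (\<lambda>_. borel))"
      unfolding end_value_def
      by (intro measurable_compose[OF _ borel_measurable_exp] borel_measurable_diff borel_measurable_sum borel_measurable_const c) auto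
    show "(\<lambda>p. left_sum h m (Suc k) (snd p)) \<in>
        borel_measurable (PiM {k} (\<lambda>_. borel) \<Otimes>\<^sub>M PiM ?J (\<lambda>_. borel))"
      unfolding left_sum_def
      by (intro borel_measurable_times measurable_compose[OF _ borel_measurable_exp] borel_measurable_diff borel_measurable_sum
          borel_measurable_const c) auto
  qed measurable
  \<comment> \<open>Restricting the increments to \<open>?J\<close> is harmless, since no index
    outside it is read.\<close>
  have GY: "G (f, ?Y \<omega>) = F (exp (f k - h / 2)) (end_value h m (Suc k) (increment h \<omega>))
      (left_sum h m (Suc k) (increment h \<omega>))" for f \<omega>
    using end_value_cong[of m "?Y \<omega>" "Suc k" "increment h \<omega>" h]
      left_sum_cong[of m "?Y \<omega>" "Suc k" "increment h \<omega>" h]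
    by (simp add: G_def)
  have g: "(\<lambda>y. \<integral>\<omega>. F (exp (y - h / 2)) (end_value h m (Suc k) (increment h \<omega>))
      (left_sum h m (Suc k) (increment h \<omega>)) \<partial>P) \<in> borel_measurable borel"
  proof (rule borel_measurable_lebesgue_integral)
    show "(\<lambda>(y, \<omega>). F (exp (y - h / 2)) (end_value h m (Suc k) (increment h \<omega>))
        (left_sum h m (Suc k) (increment h \<omega>))) \<in> borel_measurable (borel \<Otimes>\<^sub>M P)"
      unfolding case_prod_beta by (intro F') measurable
  qed
  have X: "?X \<omega> k = increment h \<omega> k" for \<omega> by simp
  have "(\<integral>\<omega>. G (?X \<omega>, ?Y \<omega>) \<partial>P) = (\<integral>\<omega>'. (\<integral>\<omega>. G (?X \<omega>', ?Y \<omega>) \<partial>P) \<partial>P)"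
    using int by (intro expectation_indep[OF ind meas]) (simp only: GY X)
  then have "(\<integral>\<omega>. F (exp (increment h \<omega> k - h / 2)) (end_value h m (Suc k) (increment h \<omega>))
      (left_sum h m (Suc k) (increment h \<omega>)) \<partial>P) =
    (\<integral>\<omega>'. (\<integral>\<omega>. F (exp (increment h \<omega>' k - h / 2)) (end_value h m (Suc k) (increment h \<omega>))
      (left_sum h m (Suc k) (increment h \<omega>)) \<partial>P) \<partial>P)"
    by (simp only: GY X)
  also have "\<dots> = (\<integral>y. (\<integral>\<omega>. F (exp (y - h / 2)) (end_value h m (Suc k) (increment h \<omega>))
      (left_sum h m (Suc k) (increment h \<omega>)) \<partial>P) \<partial>distr P borel (\<lambda>\<omega>. increment h \<omega> k))"
    by (rule integral_distr[symmetric, OF _ g]) measurable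
  also have "\<dots> = (\<integral>x. (\<integral>\<omega>. F (exp (s * x - h / 2)) (end_value h m (Suc k) (increment h \<omega>))
      (left_sum h m (Suc k) (increment h \<omega>)) \<partial>P) \<partial>std_gauss)"
    unfolding distr_increment[OF s, folded h_def] by (rule integral_distr[OF _ g]) measurable
  finally show ?thesis by (simp add: h_def)
qed

text \<open>Starting at step n - m means running the last \<open>m\<close> of \<open>n\<close>
  steps. Removing the first increment of \<open>Suc m\<close> steps then leads literally to the
  value for \<open>m\<close>, with no time shift of the whole sum.\<close>

definition put_value :: "real \<Rightarrow> nat \<Rightarrow> nat \<Rightarrow> real \<Rightarrow> real" where
  "put_value h n m a = (\<integral>\<omega>. max (a - left_sum h m (n - m) (increment h \<omega>)) 0 \<partial>P)"

text \<open>Discrete Feynman-Kac expression: the prefactor is the survival probability under killing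
  and the argument of \<open>damp\<close> is the current position of Z started at
  \<open>z\<close>.\<close>

definition damped_value :: "real \<Rightarrow> real \<Rightarrow> nat \<Rightarrow> nat \<Rightarrow> real \<Rightarrow> real" where
  "damped_value \<delta> h n m z =
    (\<integral>\<omega>. 1 / (1 + z * left_sum h m (n - m) (increment h \<omega>)) *
      damp \<delta> (z * end_value h m (n - m) (increment h \<omega>) / (1 + z * left_sum h m (n - m) (increment h \<omega>))) \<partial>P)"

lemma recursion_values:
  assumes \<delta>: "0 < \<delta>" "\<delta> \<le> 1" and s: "0 < s"
  shows "recursion (damped_value \<delta> (s\<^sup>2) n) (put_value (s\<^sup>2) n) s \<delta> n"
proof
  define h where "h = s\<^sup>2"
  have h: "0 < h" "0 \<le> h" using s by (simp_all add: h_def)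
  note [measurable] = measurable_increment[OF h(2)] measurable_end_value[OF h(2)] measurable_left_sum[OF h(2)]
  note A0 = left_sum_nonneg[OF h(2)]
  show "0 < \<delta>" "\<delta> \<le> 1" "0 < s" using assms by auto
  show "damped_value \<delta> (s\<^sup>2) n m \<in> borel_measurable borel" for m
    unfolding damped_value_def[abs_def] h_def[symmetric] by measurable
  show "put_value (s\<^sup>2) n m \<in> borel_measurable borel" for m
    unfolding put_value_def[abs_def] h_def[symmetric] by measurable
  show "damped_value \<delta> (s\<^sup>2) n 0 z = damp \<delta> z" if "0 < z" for z
    by (simp add: damped_value_def left_sum_def end_value_def prob_space)
  show "put_value (s\<^sup>2) n 0 a = a" if "0 < a" for a
    using that by (simp add: put_value_def left_sum_def prob_space)
  show "0 \<le> put_value (s\<^sup>2) n m a \<and> put_value (s\<^sup>2) n m a \<le> a" if "0 < a" for m a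
  proof -
    have b: "0 \<le> max (a - left_sum h m (n - m) (increment h \<omega>)) 0"
      "max (a - left_sum h m (n - m) (increment h \<omega>)) 0 \<le> a" for \<omega>
      using A0[of m "n - m" "increment h \<omega>"] that by auto
    have "integrable P (\<lambda>\<omega>. max (a - left_sum h m (n - m) (increment h \<omega>)) 0)"
      using b by (intro integrable_const_bound[of _ a] AE_I2) auto
    then have "put_value h n m a \<le> (\<integral>\<omega>. a \<partial>P)"
      unfolding put_value_def using b by (intro integral_mono) auto
    moreover have "0 \<le> put_value h n m a"
      unfolding put_value_def using b by (intro Bochner_Integration.integral_nonneg) auto
    ultimately show ?thesis by (simp add: prob_space h_def)
  qed
  show "damped_value \<delta> (s\<^sup>2) n (Suc m) z = (\<integral>x. damped_value \<delta> (s\<^sup>2) n m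
      (z / (1 + s\<^sup>2 * z) * exp (s * x - s\<^sup>2 / 2)) \<partial>std_gauss) / (1 + s\<^sup>2 * z)"
    if m: "m < n" and z: "0 < z" for m z
  proof -
    define k where "k = n - Suc m"
    have k: "n - m = Suc k" using m by (simp add: k_def)
    define F where "F e v y = 1 / (1 + z * (h + e * y)) * damp \<delta> (z * (e * v) / (1 + z * (h + e * y)))"
      for e v y
    have F [measurable]: "(\<lambda>(e, v, y). F e v y) \<in> borel_measurable borel"
      unfolding F_def borel_prod[symmetric] by measurable
    have hz: "1 \<le> 1 + h * z" using h z by simp
    \<comment> \<open>Factorisation 1 + z (h + e y) = (1 + h z) (1 + z' e y) with z' = z / (1 + h
      z): killing in the first step separates, and the chain restarts from z' e.\<close>
    have split: "F e v y = (1 / (1 + z / (1 + h * z) * e * y) *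
        damp \<delta> (z / (1 + h * z) * e * v / (1 + z / (1 + h * z) * e * y))) / (1 + h * z)"
      if "0 \<le> e" "0 \<le> y" for e v y
    proof -
      define g where "g = 1 + h * z"
      have g: "1 \<le> g" using hz by (simp add: g_def)
      define w where "w = 1 + z / g * e * y"
      have w: "0 < w" using g z that by (simp add: w_def add_pos_nonneg)
      have eq: "1 + z * (h + e * y) = g * w" using g by (simp add: w_def g_def field_simps)
      show ?thesis
        unfolding F_def eq w_def[symmetric] g_def[symmetric] using g w by (simp add: field_simps)
    qed
    have "damped_value \<delta> (s\<^sup>2) n (Suc m) z = (\<integral>\<omega>. F (exp (increment h \<omega> k - h / 2))
        (end_value h m (Suc k) (increment h \<omega>)) (left_sum h m (Suc k) (increment h \<omega>)) \<partial>P)"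
      by (simp add: damped_value_def F_def k_def[symmetric] h_def[symmetric] end_value_Suc left_sum_Suc)
    also have "\<dots> = (\<integral>x. (\<integral>\<omega>. F (exp (s * x - s\<^sup>2 / 2)) (end_value h m (Suc k) (increment h \<omega>))
        (left_sum h m (Suc k) (increment h \<omega>)) \<partial>P) \<partial>std_gauss)"
      unfolding h_def
    proof (rule first_step[OF s F], fold h_def)
      show "integrable P (\<lambda>\<omega>. F (exp (increment h \<omega> k - h / 2))
          (end_value h m (Suc k) (increment h \<omega>)) (left_sum h m (Suc k) (increment h \<omega>)))"
      proof (rule integrable_const_bound[of _ "1 * (4 / \<delta>)"])
        show "AE \<omega> in P. norm (F (exp (increment h \<omega> k - h / 2))
          (end_value h m (Suc k) (increment h \<omega>)) (left_sum h m (Suc k) (increment h \<omega>))) \<le> 1 * (4 / \<delta>)"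
        proof (intro AE_I2)
          fix \<omega>
          let ?e = "exp (increment h \<omega> k - h / 2)" and ?v = "end_value h m (Suc k) (increment h \<omega>)"
            and ?y = "left_sum h m (Suc k) (increment h \<omega>)"
          have v: "0 < ?v" by (simp add: end_value_def)
          have d: "1 \<le> 1 + z * (h + ?e * ?y)" using A0[of m "Suc k"] h z by simp
          have v': "0 \<le> z * (?e * ?v) / (1 + z * (h + ?e * ?y))" using d v z by simp
          show "norm (F ?e ?v ?y) \<le> 1 * (4 / \<delta>)"
            unfolding F_def real_norm_def abs_mult
            using d damp_le[OF \<delta> v'] damp_pos[OF \<delta> v'] by (intro mult_mono) auto
        qed
        show "(\<lambda>\<omega>. F (exp (increment h \<omega> k - h / 2))
          (end_value h m (Suc k) (increment h \<omega>)) (left_sum h m (Suc k) (increment h \<omega>))) \<in> borel_measurable P"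
          unfolding F_def by measurable
      qed
    qed
    also have "\<dots> = (\<integral>x. damped_value \<delta> (s\<^sup>2) n m
      (z / (1 + s\<^sup>2 * z) * exp (s * x - s\<^sup>2 / 2)) / (1 + s\<^sup>2 * z) \<partial>std_gauss)"
      unfolding damped_value_def k h_def[symmetric] integral_divide_zero[symmetric]
      by (intro Bochner_Integration.integral_cong refl split A0) simp
    finally show ?thesis by simp
  qed
  show "put_value (s\<^sup>2) n (Suc m) a = (\<integral>x. put_value (s\<^sup>2) n m ((a - s\<^sup>2) * exp (s * x - s\<^sup>2 / 2)) \<partial>std_gauss)"
    if m: "m < n" and a: "s\<^sup>2 < a" for m a
  proof -
    define k where "k = n - Suc m"
    have k: "n - m = Suc k" using m by (simp add: k_def)
    define F where "F e v y = max (a - (h + e * y)) 0" for e v y :: real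
    have F [measurable]: "(\<lambda>(e, v, y). F e v y) \<in> borel_measurable borel"
      unfolding F_def borel_prod[symmetric] by measurable
    \<comment> \<open>The put is homogeneous of degree 1, so the first exponential factor can be
      pulled out; size biasing then replaces division by it with multiplication.\<close>
    have split: "F e v y = e * max ((a - h) / e - y) 0" if "0 < e" for e v y
    proof -
      have "e * max ((a - h) / e - y) 0 = max (e * ((a - h) / e - y)) (e * 0)"
        using that by (simp add: max_mult_distrib_left)
      moreover have "e * ((a - h) / e - y) = a - (h + e * y)"
        using that by (simp add: field_simps)
      ultimately show ?thesis by (simp add: F_def)
    qed
    have "put_value (s\<^sup>2) n (Suc m) a = (\<integral>\<omega>. F (exp (increment h \<omega> k - h / 2))
        (end_value h m (Suc k) (increment h \<omega>)) (left_sum h m (Suc k) (increment h \<omega>)) \<partial>P)"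
      by (simp add: put_value_def F_def k_def[symmetric] h_def[symmetric] left_sum_Suc)
    also have "\<dots> = (\<integral>x. (\<integral>\<omega>. F (exp (s * x - s\<^sup>2 / 2)) (end_value h m (Suc k) (increment h \<omega>))
        (left_sum h m (Suc k) (increment h \<omega>)) \<partial>P) \<partial>std_gauss)"
      unfolding h_def
    proof (rule first_step[OF s F], fold h_def)
      show "integrable P (\<lambda>\<omega>. F (exp (increment h \<omega> k - h / 2))
          (end_value h m (Suc k) (increment h \<omega>)) (left_sum h m (Suc k) (increment h \<omega>)))"
      proof (rule integrable_const_bound[of _ a])
        show "AE \<omega> in P. norm (F (exp (increment h \<omega> k - h / 2))
          (end_value h m (Suc k) (increment h \<omega>)) (left_sum h m (Suc k) (increment h \<omega>))) \<le> a"
        proof (intro AE_I2)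
          fix \<omega>
          have "0 \<le> exp (increment h \<omega> k - h / 2) * left_sum h m (Suc k) (increment h \<omega>)"
            using A0 by simp
          then show "norm (F (exp (increment h \<omega> k - h / 2))
            (end_value h m (Suc k) (increment h \<omega>)) (left_sum h m (Suc k) (increment h \<omega>))) \<le> a"
            unfolding F_def using h a[folded h_def] by auto
        qed
        show "(\<lambda>\<omega>. F (exp (increment h \<omega> k - h / 2))
          (end_value h m (Suc k) (increment h \<omega>)) (left_sum h m (Suc k) (increment h \<omega>))) \<in> borel_measurable P"
          unfolding F_def by measurable
      qed
    qed
    also have "\<dots> = (\<integral>x. exp (s * x - s\<^sup>2 / 2) * put_value h n m ((a - h) / exp (s * x - s\<^sup>2 / 2)) \<partial>std_gauss)"
      unfolding put_value_def k integral_mult_right_zero[symmetric]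
      by (intro Bochner_Integration.integral_cong refl split) simp
    also have "\<dots> = (\<integral>x. put_value h n m ((a - h) / (1 / exp (s * x - s\<^sup>2 / 2))) \<partial>std_gauss)"
    proof (rule lognormal_size_bias)
      show "(\<lambda>y. put_value h n m ((a - h) / y)) \<in> borel_measurable borel"
        unfolding put_value_def by measurable
    qed
    finally show ?thesis by (simp add: h_def)
  qed
qed

end

section \<open>Passage to the limit\<close>

lemma riemann_sum_error:
  fixes F :: "real \<Rightarrow> real" and t h e :: real and m :: nat
  assumes F: "continuous_on {0..t} F" and h: "0 < h" and e: "0 \<le> e"
    and osc: "\<And>x y. x \<in> {0..t} \<Longrightarrow> y \<in> {0..t} \<Longrightarrow> \<bar>x - y\<bar> \<le> h \<Longrightarrow> \<bar>F x - F y\<bar> \<le> e"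
  shows "m * h \<le> t \<Longrightarrow> \<bar>h * (\<Sum>j<m. F (j * h)) - integral {0..m * h} F\<bar> \<le> e * (m * h)"
proof (induction m)
  case (Suc m)
  let ?a = "m * h" and ?b = "Suc m * h"
  have ab: "0 \<le> ?a" "?a \<le> ?b" "?b \<le> t" "?b - ?a = h" using h Suc.prems by (simp_all add: algebra_simps)
  have sub: "{0..?b} \<subseteq> {0..t}" "{?a..?b} \<subseteq> {0..t}" using ab by auto
  have int: "F integrable_on {0..?b}" "F integrable_on {?a..?b}"
    using continuous_on_subset[OF F] sub by (auto intro!: integrable_continuous_interval)
  have comb: "integral {0..?b} F = integral {0..?a} F + integral {?a..?b} F"
    using Henstock_Kurzweil_Integration.integral_combine[OF ab(1,2) int(1)] by simp
  have c: "((\<lambda>x. F ?a) has_integral h * F ?a) {?a..?b}"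
    using has_integral_const_real[of "F ?a" ?a ?b] ab by simp
  have d: "((\<lambda>x. F ?a - F x) has_integral h * F ?a - integral {?a..?b} F) {?a..?b}"
    by (intro has_integral_diff c integrable_integral int)
  have "norm (h * F ?a - integral {?a..?b} F) \<le> e * measure lborel {?a..?b}"
  proof (rule has_integral_bound_real[OF e finite.emptyI d])
    fix x assume "x \<in> {?a..?b} - {}"
    then show "norm (F ?a - F x) \<le> e" using osc[of ?a x] ab by auto
  qed
  then have "\<bar>h * F ?a - integral {?a..?b} F\<bar> \<le> e * h" using ab by simp
  moreover have "\<bar>h * (\<Sum>j<m. F (j * h)) - integral {0..?a} F\<bar> \<le> e * ?a"
    using Suc.IH ab by simp
  ultimately show ?case unfolding comb by (simp add: algebra_simps abs_le_iff)
qed simp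

lemma riemann_sum_tendsto:
  fixes F :: "real \<Rightarrow> real"
  assumes F: "continuous_on {0..t} F" and t: "0 < t"
  shows "(\<lambda>n. t / Suc n * (\<Sum>j<Suc n. F (j * (t / Suc n)))) \<longlonglongrightarrow> (LINT s:{0..t}|lborel. F s)"
proof -
  have "set_integrable lborel {0..t} F"
    unfolding set_integrable_def by (intro borel_integrable_compact compact_Icc F)
  then have eq: "(LINT s:{0..t}|lborel. F s) = integral {0..t} F"
    by (rule set_borel_integral_eq_integral)
  have uc: "uniformly_continuous_on {0..t} F"
    by (intro compact_uniformly_continuous F compact_Icc)
  show ?thesis unfolding eq
  proof (rule LIMSEQ_I)
    fix r :: real assume r: "0 < r"
    define e where "e = r / (2 * t)"
    have e: "0 < e" using r t by (simp add: e_def)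
    obtain d where d: "0 < d"
      "\<And>x y. x \<in> {0..t} \<Longrightarrow> y \<in> {0..t} \<Longrightarrow> dist y x < d \<Longrightarrow> dist (F y) (F x) < e"
      using uc e unfolding uniformly_continuous_on_def by metis
    obtain N :: nat where N: "t / d < N" using reals_Archimedean2 by blast
    show "\<exists>N. \<forall>n\<ge>N. norm (t / Suc n * (\<Sum>j<Suc n. F (j * (t / Suc n))) - integral {0..t} F) < r"
    proof (intro exI[of _ N] allI impI)
      fix n assume "N \<le> n"
      then have "t / d < Suc n" using N by simp
      then have h: "0 < t / Suc n" "t / Suc n < d" using t d by (simp_all add: field_simps)
      have "\<bar>t / Suc n * (\<Sum>j<Suc n. F (j * (t / Suc n))) - integral {0..Suc n * (t / Suc n)} F\<bar> \<le>
          e * (Suc n * (t / Suc n))"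
      proof (rule riemann_sum_error[OF F h(1)])
        fix x y assume "x \<in> {0..t}" "y \<in> {0..t}" "\<bar>x - y\<bar> \<le> t / Suc n"
        then show "\<bar>F x - F y\<bar> \<le> e" using d(2)[of y x] h by (simp add: dist_real_def)
      qed (use e in auto)
      also have "e * (Suc n * (t / Suc n)) < r" using r t by (simp add: e_def)
      finally show "norm (t / Suc n * (\<Sum>j<Suc n. F (j * (t / Suc n))) - integral {0..t} F) < r"
        by simp
    qed
  qed
qed

text \<open>Uniform integrability from bounded second moments: y - min y K <= y^2 / K controls what
  truncation at K loses. Dominated convergence handles each level K, and monotone convergence in K
  yields integrability and mean of the limit.\<close>

lemma (in prob_space) expectation_limit_square_bounded:
  fixes Y :: "nat \<Rightarrow> 'a \<Rightarrow> real"
  assumes [measurable]: "\<And>n. Y n \<in> borel_measurable M" "Z \<in> borel_measurable M"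
    and lim: "AE \<omega> in M. (\<lambda>n. Y n \<omega>) \<longlonglongrightarrow> Z \<omega>"
    and nonneg: "\<And>n \<omega>. 0 \<le> Y n \<omega>"
    and int: "\<And>n. integrable M (Y n)" "\<And>n. integrable M (\<lambda>\<omega>. (Y n \<omega>)\<^sup>2)"
    and mean: "\<And>n. expectation (Y n) = c" and square: "\<And>n. expectation (\<lambda>\<omega>. (Y n \<omega>)\<^sup>2) \<le> C"
  shows "integrable M Z" "expectation Z = c"
proof -
  have Z: "AE \<omega> in M. 0 \<le> Z \<omega>"
    using lim by eventually_elim (rule LIMSEQ_le_const, use nonneg in auto)
  have bdd: "\<bar>min (Y n \<omega>) K\<bar> \<le> K" if "0 < K" for K n \<omega>
    using nonneg[of n \<omega>] that by simp
  have trunc: "(\<lambda>n. expectation (\<lambda>\<omega>. min (Y n \<omega>) K)) \<longlonglongrightarrow> expectation (\<lambda>\<omega>. min (Z \<omega>) K)"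
    if "0 < K" for K
  proof (rule integral_dominated_convergence[where w = "\<lambda>_. K"])
    show "AE \<omega> in M. (\<lambda>n. min (Y n \<omega>) K) \<longlonglongrightarrow> min (Z \<omega>) K"
      using lim by eventually_elim (intro tendsto_min tendsto_const)
    show "AE \<omega> in M. norm (min (Y n \<omega>) K) \<le> K" for n
      using bdd[OF that] by simp
  qed auto
  have iY: "integrable M (\<lambda>\<omega>. min (Y n \<omega>) K)" if "0 < K" for n K
    using bdd[OF that] by (intro integrable_const_bound[of _ K] AE_I2) auto
  have iZ: "integrable M (\<lambda>\<omega>. min (Z \<omega>) K)" if "0 < K" for K
    using Z that by (intro integrable_const_bound[of _ K]) (auto simp: abs_if min_def elim!: eventually_mono)
  have upper: "expectation (\<lambda>\<omega>. min (Z \<omega>) K) \<le> c" if "0 < K" for K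
  proof (rule LIMSEQ_le_const2[OF trunc[OF that]], intro exI allI impI)
    show "expectation (\<lambda>\<omega>. min (Y n \<omega>) K) \<le> c" for n
      using integral_mono[OF iY[OF that, of n] int(1)[of n]] mean[of n] by simp
  qed
  have lower: "c - C / K \<le> expectation (\<lambda>\<omega>. min (Z \<omega>) K)" if "0 < K" for K
  proof (rule LIMSEQ_le_const[OF trunc[OF that]], intro exI allI impI)
    fix n
    have "expectation (Y n) - expectation (\<lambda>\<omega>. min (Y n \<omega>) K) =
        expectation (\<lambda>\<omega>. Y n \<omega> - min (Y n \<omega>) K)"
      using int(1)[of n] iY[OF that, of n] by simp
    also have "\<dots> \<le> expectation (\<lambda>\<omega>. (Y n \<omega>)\<^sup>2 / K)"
    proof (rule integral_mono)
      fix \<omega>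
      show "Y n \<omega> - min (Y n \<omega>) K \<le> (Y n \<omega>)\<^sup>2 / K"
      proof (cases "Y n \<omega> \<le> K")
        case False
        then have "Y n \<omega> * K \<le> Y n \<omega> * Y n \<omega>" using nonneg[of n \<omega>] by (intro mult_left_mono) auto
        then have "Y n \<omega> \<le> (Y n \<omega>)\<^sup>2 / K" using that by (simp add: field_simps power2_eq_square)
        then show ?thesis using False that by simp
      qed (use that in simp)
    qed (use int iY[OF that] in auto)
    also have "\<dots> \<le> C / K" using square[of n] that by (simp add: divide_right_mono)
    finally show "c - C / K \<le> expectation (\<lambda>\<omega>. min (Y n \<omega>) K)" using mean[of n] by simp
  qed
  have ilim: "(\<lambda>i. expectation (\<lambda>\<omega>. min (Z \<omega>) (Suc i))) \<longlonglongrightarrow> c"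
  proof (rule tendsto_sandwich)
    show "\<forall>\<^sub>F i in sequentially. c - C / Suc i \<le> expectation (\<lambda>\<omega>. min (Z \<omega>) (Suc i))"
      by (intro always_eventually allI lower) simp
    show "\<forall>\<^sub>F i in sequentially. expectation (\<lambda>\<omega>. min (Z \<omega>) (Suc i)) \<le> c"
      by (intro always_eventually allI upper) simp
    have "(\<lambda>i. c - C * (1 / Suc i)) \<longlonglongrightarrow> c - C * 0"
      by (intro tendsto_intros LIMSEQ_Suc[OF lim_1_over_n])
    then show "(\<lambda>i. c - C / Suc i) \<longlonglongrightarrow> c" by simp
  qed simp
  have mono: "AE \<omega> in M. mono (\<lambda>i. min (Z \<omega>) (real (Suc i)))"
    by (intro AE_I2) (auto simp: mono_def min_def)
  have plim: "AE \<omega> in M. (\<lambda>i. min (Z \<omega>) (real (Suc i))) \<longlonglongrightarrow> Z \<omega>"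
  proof (intro AE_I2 tendsto_eventually)
    fix \<omega>
    obtain N :: nat where "Z \<omega> < N" using reals_Archimedean2 by blast
    then show "\<forall>\<^sub>F i in sequentially. min (Z \<omega>) (real (Suc i)) = Z \<omega>"
      by (intro eventually_sequentiallyI[of N]) (auto simp: min_def)
  qed
  have pos: "AE \<omega> in M. 0 \<le> min (Z \<omega>) (real (Suc i))" for i
    using Z by eventually_elim simp
  show "integrable M Z" "expectation Z = c"
    using integral_monotone_convergence_nonneg[OF iZ mono pos plim ilim] by simp_all
qed

section \<open>Moments of the Riemann sums and vanishing mesh\<close>

context standard_brownian_motion
begin

lemma exp_moment:
  assumes "0 \<le> u"
  shows "integrable P (\<lambda>\<omega>. exp (c * (B u \<omega> - B 0 \<omega>)))"
    and "expectation (\<lambda>\<omega>. exp (c * (B u \<omega> - B 0 \<omega>))) = exp (c\<^sup>2 * u / 2)"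
proof -
  have [measurable]: "B u \<in> borel_measurable P" "B 0 \<in> borel_measurable P"
    using random_variable_B assms by auto
  have "integrable P (\<lambda>\<omega>. exp (c * (B u \<omega> - B 0 \<omega>))) \<and>
    expectation (\<lambda>\<omega>. exp (c * (B u \<omega> - B 0 \<omega>))) = exp (c\<^sup>2 * u / 2)"
  proof (cases "u = 0")
    case False
    then have u: "0 < sqrt u" "0 < u" using assms by auto
    have "distributed P lborel (\<lambda>\<omega>. B u \<omega> - B 0 \<omega>) (normal_density 0 (sqrt (u - 0)))"
      using u by (intro gaussian_increments) auto
    then have "distr P lborel (\<lambda>\<omega>. B u \<omega> - B 0 \<omega>) = density lborel (normal_density 0 (sqrt u))"
      by (intro distributed_distr_eq_density) simp
    then have d: "distr P borel (\<lambda>\<omega>. B u \<omega> - B 0 \<omega>) = distr std_gauss borel (\<lambda>x. sqrt u * x)"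
      using distr_scaled_std_gauss[OF u(1)] by (simp cong: distr_cong)
    have "integrable std_gauss (\<lambda>x. exp ((c * sqrt u) * x - 0))"
      by (rule integrable_std_gauss_exp_linear)
    then have "integrable (distr std_gauss borel (\<lambda>x. sqrt u * x)) (\<lambda>y. exp (c * y))"
      by (subst integrable_distr_eq) (auto simp: mult.assoc)
    then have "integrable P (\<lambda>\<omega>. exp (c * (B u \<omega> - B 0 \<omega>)))"
      unfolding d[symmetric] by (subst (asm) integrable_distr_eq) auto
    moreover have "expectation (\<lambda>\<omega>. exp (c * (B u \<omega> - B 0 \<omega>))) =
        (\<integral>y. exp (c * y) \<partial>distr P borel (\<lambda>\<omega>. B u \<omega> - B 0 \<omega>))"
      by (subst integral_distr) auto
    moreover have "\<dots> = (\<integral>x. exp (c * (sqrt u * x)) \<partial>std_gauss)"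
      unfolding d by (subst integral_distr) auto
    moreover have "\<dots> = (\<integral>x. exp (c\<^sup>2 * u / 2) * exp ((c * sqrt u) * x - (c * sqrt u)\<^sup>2 / 2) \<partial>std_gauss)"
      using assms by (intro Bochner_Integration.integral_cong refl)
        (simp add: power_mult_distrib mult.assoc flip: exp_add)
    moreover have "\<dots> = exp (c\<^sup>2 * u / 2)"
      by (simp only: integral_mult_right_zero integral_std_gauss_exp_linear mult_1_right)
    ultimately show ?thesis by simp
  qed (simp add: prob_space)
  then show "integrable P (\<lambda>\<omega>. exp (c * (B u \<omega> - B 0 \<omega>)))"
    and "expectation (\<lambda>\<omega>. exp (c * (B u \<omega> - B 0 \<omega>))) = exp (c\<^sup>2 * u / 2)"
    by auto
qed

text \<open>The second moment comes from Cauchy-Schwarz for the sum and the Gaussian exponential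
  moments. Its bound depends on \<open>m * h\<close> only, hence is uniform in the mesh once m h =
  t.\<close>

lemma left_sum_moments:
  assumes h: "0 < h"
  shows "integrable P (\<lambda>\<omega>. left_sum h m 0 (increment h \<omega>))"
    and "expectation (\<lambda>\<omega>. left_sum h m 0 (increment h \<omega>)) = m * h"
    and "integrable P (\<lambda>\<omega>. (left_sum h m 0 (increment h \<omega>))\<^sup>2)"
    and "expectation (\<lambda>\<omega>. (left_sum h m 0 (increment h \<omega>))\<^sup>2) \<le> (m * h)\<^sup>2 * exp (m * h)"
proof -
  define X where "X j \<omega> = exp (B (real j * h) \<omega> - B 0 \<omega> - real j * h / 2)" for j \<omega>
  have S: "left_sum h m 0 (increment h \<omega>) = h * (\<Sum>j<m. X j \<omega>)" for \<omega>
    by (simp add: left_sum_increment X_def)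
  have X1: "X j \<omega> = exp (- (real j * h / 2)) * exp (1 * (B (real j * h) \<omega> - B 0 \<omega>))" for j \<omega>
    by (simp add: X_def flip: exp_add)
  have X2: "(X j \<omega>)\<^sup>2 = exp (- (real j * h)) * exp (2 * (B (real j * h) \<omega> - B 0 \<omega>))" for j \<omega>
    by (simp add: X_def power2_eq_square flip: exp_add)
  have h0: "0 \<le> real j * h" for j using h by simp
  have iX: "integrable P (X j)" for j
    unfolding X1[abs_def] by (intro integrable_mult_right exp_moment h0)
  have EX: "expectation (X j) = 1" for j
    unfolding X1[abs_def] integral_mult_right_zero exp_moment[OF h0] by (simp flip: exp_add)
  have iX2: "integrable P (\<lambda>\<omega>. (X j \<omega>)\<^sup>2)" for j
    unfolding X2 by (intro integrable_mult_right exp_moment h0)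
  have EX2: "expectation (\<lambda>\<omega>. (X j \<omega>)\<^sup>2) = exp (real j * h)" for j
    unfolding X2 integral_mult_right_zero exp_moment[OF h0] by (simp flip: exp_add)
  show "integrable P (\<lambda>\<omega>. left_sum h m 0 (increment h \<omega>))"
    unfolding S using iX by simp
  show "expectation (\<lambda>\<omega>. left_sum h m 0 (increment h \<omega>)) = m * h"
    unfolding S using iX EX by simp
  have bound: "(left_sum h m 0 (increment h \<omega>))\<^sup>2 \<le> h\<^sup>2 * m * (\<Sum>j<m. (X j \<omega>)\<^sup>2)" for \<omega>
  proof -
    have "(\<Sum>j<m. X j \<omega>)\<^sup>2 \<le> (\<Sum>j<m. (X j \<omega>)\<^sup>2) * card {..<m}"
      by (rule sum_squared_le_sum_of_squares)
    then have "h\<^sup>2 * (\<Sum>j<m. X j \<omega>)\<^sup>2 \<le> h\<^sup>2 * ((\<Sum>j<m. (X j \<omega>)\<^sup>2) * m)"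
      by (intro mult_left_mono) auto
    then show ?thesis by (simp add: S power_mult_distrib mult_ac)
  qed
  have ib: "integrable P (\<lambda>\<omega>. h\<^sup>2 * m * (\<Sum>j<m. (X j \<omega>)\<^sup>2))"
    using iX2 by simp
  have [measurable]: "(\<lambda>\<omega>. left_sum h m 0 (increment h \<omega>)) \<in> borel_measurable P"
    using h by (intro measurable_left_sum) auto
  show i2: "integrable P (\<lambda>\<omega>. (left_sum h m 0 (increment h \<omega>))\<^sup>2)"
    by (rule Bochner_Integration.integrable_bound[OF ib]) (use bound in \<open>auto intro!: AE_I2 order_trans[OF _ abs_ge_self]\<close>)
  have "expectation (\<lambda>\<omega>. (left_sum h m 0 (increment h \<omega>))\<^sup>2) \<le>
      expectation (\<lambda>\<omega>. h\<^sup>2 * m * (\<Sum>j<m. (X j \<omega>)\<^sup>2))"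
    using i2 ib bound by (intro integral_mono)
  also have "\<dots> = h\<^sup>2 * m * (\<Sum>j<m. exp (real j * h))"
    using iX2 EX2 by simp
  also have "\<dots> \<le> h\<^sup>2 * m * (\<Sum>j<m. exp (real m * h))"
    using h by (intro mult_left_mono sum_mono) (auto intro!: mult_right_mono)
  also have "\<dots> = (m * h)\<^sup>2 * exp (m * h)"
    by (simp add: power2_eq_square mult_ac)
  finally show "expectation (\<lambda>\<omega>. (left_sum h m 0 (increment h \<omega>))\<^sup>2) \<le> (m * h)\<^sup>2 * exp (m * h)" .
qed

text \<open>With n s^2 = t the accumulated factor (1 + H s^3)^n is at most exp (H t s). For fixed
  \<epsilon> and \<delta> the constant \<open>H\<close> does not depend on n, so this factor tends
  to 1.\<close>

lemma comparison_values:
  assumes t: "0 < t" and a: "0 < a" and n: "0 < n" and \<delta>: "0 < \<delta>" "\<delta> \<le> 1"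
    and \<epsilon>: "0 < \<epsilon>" "\<epsilon> \<le> 1" "sqrt (t / n) \<le> \<epsilon> / 2"
    and \<beta>: "\<epsilon> \<le> \<beta>" "\<And>z. 0 < z \<Longrightarrow> \<delta> * damp \<delta> z \<le> \<beta>"
  defines "H \<equiv> step_const (1 / \<epsilon>) * (4 / \<delta> + (48 / \<delta>\<^sup>2 + t * (4 / \<delta>)) + 1)"
  shows "\<bar>put_value (t / n) n n a - a * exp (- 2 / a) * damped_value \<delta> (t / n) n n (1 / a)\<bar> \<le>
    \<beta> + ((exp t * \<epsilon> / \<delta> + 1) * exp (H * t * sqrt (t / n)) - 1) * (a * exp (- 2 / a))"
proof -
  define s where "s = sqrt (t / n)"
  have sp: "0 < s" "s\<^sup>2 = t / n" using t n by (simp_all add: s_def)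
  interpret recursion "damped_value \<delta> (t / n) n" "put_value (t / n) n" s \<delta> n
    using recursion_values[OF \<delta> sp(1), of n] unfolding sp(2) .
  have ns: "n * s\<^sup>2 = t" using n by (simp add: sp(2))
  have "\<bar>put_value (t / n) n n a - a * exp (- 2 / a) * damped_value \<delta> (t / n) n n (1 / a)\<bar> \<le>
    \<beta> + ((exp t * \<epsilon> / \<delta> + 1) * (1 + H * s ^ 3) ^ n - 1) * (a * exp (- 2 / a))"
    unfolding H_def
    using comparison[OF \<epsilon>(1,2) \<epsilon>(3)[folded s_def] \<beta> eq_refl[OF ns] order_refl a] .
  also have "\<dots> \<le> \<beta> + ((exp t * \<epsilon> / \<delta> + 1) * exp (H * t * s) - 1) * (a * exp (- 2 / a))"
  proof -
    have H: "0 \<le> H" unfolding H_def using step_const_nonneg[of "1 / \<epsilon>"] \<epsilon> \<delta> t by simp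
    then have "0 \<le> H * s ^ 3" using sp by simp
    then have "(1 + H * s ^ 3) ^ n \<le> exp (H * s ^ 3) ^ n"
      using exp_ge_add_one_self[of "H * s ^ 3"] by (intro power_mono) auto
    also have "\<dots> = exp (H * t * s)"
      unfolding exp_of_nat_mult[symmetric] ns[symmetric] by (simp add: power2_eq_square power3_eq_cube mult_ac)
    finally have "(exp t * \<epsilon> / \<delta> + 1) * (1 + H * s ^ 3) ^ n \<le> (exp t * \<epsilon> / \<delta> + 1) * exp (H * t * s)"
      using \<epsilon> \<delta> by (intro mult_left_mono) auto
    then show ?thesis using a by (intro add_left_mono mult_right_mono) auto
  qed
  finally show ?thesis by (simp add: s_def)
qed

lemma continuous_exp_martingale:
  "\<omega> \<in> space P \<Longrightarrow> continuous_on {0..} (\<lambda>s. exp_martingale B s \<omega>)"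
  unfolding exp_martingale_def by (intro continuous_intros continuous_paths) auto

lemma exp_functional_riemann:
  assumes "\<omega> \<in> space P" "0 < t"
  shows "(\<lambda>n. t / Suc n * (\<Sum>j<Suc n. exp_martingale B (j * (t / Suc n)) \<omega>)) \<longlonglongrightarrow> exp_functional B t \<omega>"
  unfolding exp_functional_def
  using assms by (intro riemann_sum_tendsto continuous_on_subset[OF continuous_exp_martingale]) auto

lemma measurable_exp_martingale: "0 \<le> t \<Longrightarrow> exp_martingale B t \<in> borel_measurable P"
  unfolding exp_martingale_def[abs_def] using random_variable_B[of t] by measurable

lemma measurable_exp_functional:
  assumes "0 < t"
  shows "exp_functional B t \<in> borel_measurable P"
proof (rule borel_measurable_LIMSEQ_real)
  show "(\<lambda>n. t / Suc n * (\<Sum>j<Suc n. exp_martingale B (j * (t / Suc n)) \<omega>)) \<longlonglongrightarrow> exp_functional B t \<omega>"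
    if "\<omega> \<in> space P" for \<omega>
    using exp_functional_riemann[OF that assms] .
  show "(\<lambda>\<omega>. t / Suc n * (\<Sum>j<Suc n. exp_martingale B (j * (t / Suc n)) \<omega>)) \<in> borel_measurable P" for n
    using assms by (intro borel_measurable_times borel_measurable_const borel_measurable_sum
        measurable_exp_martingale) auto
qed

lemma exp_functional_nonneg: "0 \<le> exp_functional B t \<omega>"
  unfolding exp_functional_def set_lebesgue_integral_def
  by (intro Bochner_Integration.integral_nonneg) (auto simp: exp_martingale_def)

text \<open>The grid ends exactly at t, so the end value needs no limit. Both claims hold almost
  surely because the increments see B relative to \<open>B 0\<close>, which vanishes only almost
  surely.\<close>

lemma AE_discrete_limits:
  assumes t: "0 < t"
  shows "AE \<omega> in P. (\<lambda>n. left_sum (t / Suc n) (Suc n) 0 (increment (t / Suc n) \<omega>)) \<longlonglongrightarrow> exp_functional B t \<omega>"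
    and "AE \<omega> in P. \<forall>n. end_value (t / Suc n) (Suc n) 0 (increment (t / Suc n) \<omega>) = exp_martingale B t \<omega>"
proof -
  show "AE \<omega> in P. (\<lambda>n. left_sum (t / Suc n) (Suc n) 0 (increment (t / Suc n) \<omega>)) \<longlonglongrightarrow> exp_functional B t \<omega>"
    using start AE_space
  proof eventually_elim
    case (elim \<omega>)
    then show ?case
      using exp_functional_riemann[OF elim(2) t] by (simp add: left_sum_increment exp_martingale_def)
  qed
  show "AE \<omega> in P. \<forall>n. end_value (t / Suc n) (Suc n) 0 (increment (t / Suc n) \<omega>) = exp_martingale B t \<omega>"
    using start by eventually_elim (simp add: end_value_increment exp_martingale_def del: of_nat_Suc)
qed

lemma exp_functional_mean:
  assumes t: "0 < t"
  shows "integrable P (exp_functional B t)" "expectation (exp_functional B t) = t"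
proof -
  let ?Y = "\<lambda>n \<omega>. left_sum (t / Suc n) (Suc n) 0 (increment (t / Suc n) \<omega>)"
  have h: "0 < t / Suc n" "real (Suc n) * (t / Suc n) = t" for n using t by auto
  have Y: "?Y n \<in> borel_measurable P" for n
    using h[of n] by (intro measurable_left_sum) auto
  have sq: "expectation (\<lambda>\<omega>. (?Y n \<omega>)\<^sup>2) \<le> t\<^sup>2 * exp t" for n
    using left_sum_moments(4)[OF h(1)[of n], of "Suc n"] unfolding h(2) .
  have mean: "expectation (?Y n) = t" for n
    using left_sum_moments(2)[OF h(1)[of n], of "Suc n"] unfolding h(2) .
  have nn: "0 \<le> ?Y n \<omega>" for n \<omega> using h(1)[of n] by (intro left_sum_nonneg) auto
  show "integrable P (exp_functional B t)" "expectation (exp_functional B t) = t"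
    using expectation_limit_square_bounded[of ?Y, OF Y measurable_exp_functional[OF t]
        AE_discrete_limits(1)[OF t] nn left_sum_moments(1)[OF h(1)] left_sum_moments(3)[OF h(1)] mean sq]
    by auto
qed

text \<open>The mesh tends to 0 first: \<open>H\<close> blows up as \<epsilon> shrinks but is
  multiplied by sqrt (t / n). Then \<epsilon> -> 0 removes the contribution of the cut near a = 0.
  What remains is the initial damping error, which does not involve \<epsilon>.\<close>

lemma damped_identity:
  assumes t: "0 < t" and a: "0 < a" and \<delta>: "0 < \<delta>" "\<delta> \<le> 1" and e: "0 < e"
  shows "\<bar>expectation (\<lambda>\<omega>. max (a - exp_functional B t \<omega>) 0) - a * exp (- 2 / a) *
      expectation (\<lambda>\<omega>. 1 / (1 + 1 / a * exp_functional B t \<omega>) *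
        damp \<delta> (1 / a * exp_martingale B t \<omega> / (1 + 1 / a * exp_functional B t \<omega>)))\<bar> \<le>
    e + \<delta> * exp (2 / e)"
    (is "\<bar>?p - ?\<psi> * ?q\<bar> \<le> ?\<beta>")
proof -
  let ?Y = "\<lambda>n \<omega>. left_sum (t / Suc n) (Suc n) 0 (increment (t / Suc n) \<omega>)"
  let ?X = "\<lambda>n \<omega>. end_value (t / Suc n) (Suc n) 0 (increment (t / Suc n) \<omega>)"
  have h: "0 < t / Suc n" for n using t by simp
  have h0: "0 \<le> t / Suc n" for n using t by simp
  have [measurable]: "?Y n \<in> borel_measurable P" "?X n \<in> borel_measurable P" for n
    using measurable_left_sum[OF h0] measurable_end_value[OF h0] by auto
  note [measurable] = measurable_exp_functional[OF t] measurable_exp_martingale[OF less_imp_le[OF t]]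
  have Y0: "0 \<le> ?Y n \<omega>" for n \<omega> by (rule left_sum_nonneg[OF h0])
  have X0: "0 < ?X n \<omega>" for n \<omega> by (simp add: end_value_def)
  have p: "(\<lambda>n. put_value (t / Suc n) (Suc n) (Suc n) a) \<longlonglongrightarrow> ?p"
    unfolding put_value_def diff_self_eq_0
  proof (rule integral_dominated_convergence[where w = "\<lambda>_. a"])
    show "AE \<omega> in P. (\<lambda>n. max (a - ?Y n \<omega>) 0) \<longlonglongrightarrow> max (a - exp_functional B t \<omega>) 0"
      using AE_discrete_limits(1)[OF t] by eventually_elim (intro tendsto_intros)
    show "AE \<omega> in P. norm (max (a - ?Y n \<omega>) 0) \<le> a" for n
      using Y0 a by (intro AE_I2) auto
  qed (auto simp del: of_nat_Suc)
  have q: "(\<lambda>n. damped_value \<delta> (t / Suc n) (Suc n) (Suc n) (1 / a)) \<longlonglongrightarrow> ?q"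
    unfolding damped_value_def diff_self_eq_0
  proof (rule integral_dominated_convergence[where w = "\<lambda>_. 1 * (4 / \<delta>)"])
    show "AE \<omega> in P. (\<lambda>n. 1 / (1 + 1 / a * ?Y n \<omega>) * damp \<delta> (1 / a * ?X n \<omega> / (1 + 1 / a * ?Y n \<omega>)))
      \<longlonglongrightarrow> 1 / (1 + 1 / a * exp_functional B t \<omega>) *
        damp \<delta> (1 / a * exp_martingale B t \<omega> / (1 + 1 / a * exp_functional B t \<omega>))"
      using AE_discrete_limits[OF t]
    proof eventually_elim
      case (elim \<omega>)
      have A: "1 + 1 / a * exp_functional B t \<omega> \<noteq> 0"
        using exp_functional_nonneg[of t \<omega>] a by (simp add: add_nonneg_eq_0_iff)
      have "0 \<le> 1 / a * exp_martingale B t \<omega> / (1 + 1 / a * exp_functional B t \<omega>)"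
        using exp_functional_nonneg[of t \<omega>] a by (simp add: exp_martingale_def)
      from damp_denominator_pos[OF \<delta> this] show ?case
        unfolding damp_def elim(2)[rule_format]
        by (intro tendsto_intros elim(1) A) auto
    qed
    show "AE \<omega> in P. norm (1 / (1 + 1 / a * ?Y n \<omega>) * damp \<delta> (1 / a * ?X n \<omega> / (1 + 1 / a * ?Y n \<omega>)))
        \<le> 1 * (4 / \<delta>)" for n
    proof (intro AE_I2)
      fix \<omega>
      have d: "1 \<le> 1 + 1 / a * ?Y n \<omega>" using Y0[of n \<omega>] a by simp
      have z: "0 \<le> 1 / a * ?X n \<omega> / (1 + 1 / a * ?Y n \<omega>)" using d X0[of n \<omega>] a by simp
      show "norm (1 / (1 + 1 / a * ?Y n \<omega>) * damp \<delta> (1 / a * ?X n \<omega> / (1 + 1 / a * ?Y n \<omega>))) \<le> 1 * (4 / \<delta>)"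
        unfolding real_norm_def abs_mult
        using d damp_le[OF \<delta> z] damp_pos[OF \<delta> z] by (intro mult_mono) auto
    qed
  qed (auto simp del: of_nat_Suc)
  have s0: "(\<lambda>n. sqrt (t / Suc n)) \<longlonglongrightarrow> 0"
  proof -
    have "(\<lambda>n. sqrt (t * (1 / Suc n))) \<longlonglongrightarrow> sqrt (t * 0)"
      by (intro tendsto_intros LIMSEQ_Suc[OF lim_1_over_n])
    then show ?thesis by simp
  qed
  \<comment> \<open>The condition \<epsilon> <= e secures \<epsilon> <= \<beta>, as the comparison
    requires.\<close>
  have bound: "\<bar>?p - ?\<psi> * ?q\<bar> \<le> ?\<beta> + exp t * \<epsilon> / \<delta> * ?\<psi>" if \<epsilon>: "0 < \<epsilon>" "\<epsilon> \<le> 1" "\<epsilon> \<le> e" for \<epsilon>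
  proof -
    define H where "H = step_const (1 / \<epsilon>) * (4 / \<delta> + (48 / \<delta>\<^sup>2 + t * (4 / \<delta>)) + 1)"
    have \<beta>: "\<epsilon> \<le> ?\<beta>" using \<epsilon> \<delta> by (simp add: add_increasing2)
    have "\<forall>\<^sub>F n in sequentially. sqrt (t / Suc n) < \<epsilon> / 2"
      using s0 \<epsilon> by (intro order_tendstoD(2)) auto
    then have ev: "\<forall>\<^sub>F n in sequentially.
        \<bar>put_value (t / Suc n) (Suc n) (Suc n) a - ?\<psi> * damped_value \<delta> (t / Suc n) (Suc n) (Suc n) (1 / a)\<bar> \<le>
        ?\<beta> + ((exp t * \<epsilon> / \<delta> + 1) * exp (H * t * sqrt (t / Suc n)) - 1) * ?\<psi>"
    proof eventually_elim
      case (elim n)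
      show ?case unfolding H_def
        by (rule comparison_values[OF t a _ \<delta> \<epsilon>(1,2) less_imp_le[OF elim] \<beta> damp_small[OF \<delta> e]]) auto
    qed
    have L: "(\<lambda>n. \<bar>put_value (t / Suc n) (Suc n) (Suc n) a -
        ?\<psi> * damped_value \<delta> (t / Suc n) (Suc n) (Suc n) (1 / a)\<bar>) \<longlonglongrightarrow> \<bar>?p - ?\<psi> * ?q\<bar>"
      by (intro tendsto_intros p q)
    have R: "(\<lambda>n. ?\<beta> + ((exp t * \<epsilon> / \<delta> + 1) * exp (H * t * sqrt (t / Suc n)) - 1) * ?\<psi>) \<longlonglongrightarrow>
        ?\<beta> + ((exp t * \<epsilon> / \<delta> + 1) * exp (H * t * 0) - 1) * ?\<psi>"
      by (intro tendsto_intros s0)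
    show ?thesis using tendsto_le[OF _ R L ev] by simp
  qed
  show ?thesis
  proof (rule field_le_epsilon)
    fix d :: real assume d: "0 < d"
    define c where "c = exp t / \<delta> * ?\<psi>"
    have c: "0 < c" using \<delta> a by (simp add: c_def)
    define \<epsilon> where "\<epsilon> = min (min 1 e) (d / c)"
    have "\<bar>?p - ?\<psi> * ?q\<bar> \<le> ?\<beta> + exp t * \<epsilon> / \<delta> * ?\<psi>"
      by (rule bound) (use e d c in \<open>auto simp: \<epsilon>_def\<close>)
    also have "exp t * \<epsilon> / \<delta> * ?\<psi> = c * \<epsilon>" by (simp add: c_def)
    also have "c * \<epsilon> \<le> c * (d / c)" using c by (intro mult_left_mono) (auto simp: \<epsilon>_def)
    also have "\<dots> = d" using c by simp
    finally show "\<bar>?p - ?\<psi> * ?q\<bar> \<le> ?\<beta> + d" by simp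
  qed
qed

end

section \<open>Removal of the damping\<close>

context standard_brownian_motion
begin

text \<open>Along \<delta> = 1/(i + 1) the damped integrands increase and their expectations
  converge to the finite number p / psi. Monotone convergence therefore gives integrability of the
  limit and its value together.\<close>

lemma put_identity:
  assumes t: "0 < t" and a: "0 < a"
  defines "u \<equiv> \<lambda>\<omega>. inverse (a + exp_functional B t \<omega>) *
    exp (2 * exp_martingale B t \<omega> / (a + exp_functional B t \<omega>) - 2 / a)"
  shows "integrable P u"
    and "expectation (\<lambda>\<omega>. max (a - exp_functional B t \<omega>) 0) = a\<^sup>2 * expectation u"
proof -
  note [measurable] = measurable_exp_functional[OF t] measurable_exp_martingale[OF less_imp_le[OF t]]
  define p where "p = expectation (\<lambda>\<omega>. max (a - exp_functional B t \<omega>) 0)"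
  define \<psi> where "\<psi> = a * exp (- 2 / a)"
  have \<psi>: "0 < \<psi>" using a by (simp add: \<psi>_def)
  define w where "w \<omega> = 1 + 1 / a * exp_functional B t \<omega>" for \<omega>
  define z where "z \<omega> = 1 / a * exp_martingale B t \<omega> / w \<omega>" for \<omega>
  have w: "1 \<le> w \<omega>" for \<omega> using exp_functional_nonneg[of t \<omega>] a by (simp add: w_def)
  have z: "0 < z \<omega>" for \<omega> using w[of \<omega>] a by (simp add: z_def exp_martingale_def)
  have [measurable]: "w \<in> borel_measurable P" "z \<in> borel_measurable P"
    unfolding w_def[abs_def] z_def[abs_def] by measurable
  define g where "g i \<omega> = 1 / w \<omega> * damp (1 / Suc i) (z \<omega>)" for i \<omega>
  have \<delta>: "0 < 1 / real (Suc i)" "1 / real (Suc i) \<le> 1" for i by auto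
  have g0: "0 \<le> g i \<omega>" for i \<omega>
    using w[of \<omega>] damp_pos[OF \<delta> less_imp_le[OF z]] by (simp add: g_def less_imp_le del: of_nat_Suc)
  have gi: "integrable P (g i)" for i
  proof (rule integrable_const_bound[of _ "1 * (4 / (1 / Suc i))"])
    show "AE \<omega> in P. norm (g i \<omega>) \<le> 1 * (4 / (1 / Suc i))"
    proof (intro AE_I2)
      fix \<omega>
      show "norm (g i \<omega>) \<le> 1 * (4 / (1 / Suc i))"
        unfolding g_def real_norm_def abs_mult
        using w[of \<omega>] damp_le[OF \<delta>[of i] less_imp_le[OF z[of \<omega>]]]
          damp_pos[OF \<delta>[of i] less_imp_le[OF z[of \<omega>]]]
        by (intro mult_mono) (auto simp del: of_nat_Suc)
    qed
  qed (simp add: g_def[abs_def])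
  have gmono: "mono (\<lambda>i. g i \<omega>)" for \<omega>
  proof (rule monoI)
    fix i j :: nat assume "i \<le> j"
    then have "1 / real (Suc j) * z \<omega> \<le> 1 / real (Suc i) * z \<omega>"
      using z[of \<omega>] by (intro mult_right_mono frac_le) auto
    then have "damp (1 / Suc i) (z \<omega>) \<le> damp (1 / Suc j) (z \<omega>)"
      unfolding damp_def using damp_denominator_pos[OF \<delta>[of j] less_imp_le[OF z]]
      by (intro frac_le) auto
    then show "g i \<omega> \<le> g j \<omega>"
      unfolding g_def using w[of \<omega>] by (intro mult_left_mono) auto
  qed
  have glim: "(\<lambda>i. g i \<omega>) \<longlonglongrightarrow> 1 / w \<omega> * exp (2 * z \<omega>)" for \<omega>
  proof -
    have "(\<lambda>i. g i \<omega>) \<longlonglongrightarrow> 1 / w \<omega> * (1 / (exp (- (2 * z \<omega>)) + 0 * z \<omega>))"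
      unfolding g_def damp_def by (intro tendsto_intros LIMSEQ_Suc[OF lim_1_over_n]) auto
    then show ?thesis by (simp add: exp_minus inverse_eq_divide)
  qed
  have "(\<lambda>i. p - \<psi> * expectation (g i)) \<longlonglongrightarrow> 0"
  proof (rule LIMSEQ_I)
    fix r :: real assume r: "0 < r"
    \<comment> \<open>The error bound e + \<delta> exp (2/e) is used with e = r/2; for this fixed e
      the second term falls below r/2 as \<delta> -> 0.\<close>
    have "(\<lambda>i. 1 / Suc i * exp (2 / (r / 2))) \<longlonglongrightarrow> 0 * exp (2 / (r / 2))"
      by (intro tendsto_intros LIMSEQ_Suc[OF lim_1_over_n])
    then have "\<forall>\<^sub>F i in sequentially. 1 / Suc i * exp (2 / (r / 2)) < r / 2"
      using r by (intro order_tendstoD(2)) auto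
    then obtain N where N: "\<And>i. N \<le> i \<Longrightarrow> 1 / Suc i * exp (2 / (r / 2)) < r / 2"
      unfolding eventually_sequentially by blast
    show "\<exists>N. \<forall>i\<ge>N. norm (p - \<psi> * expectation (g i) - 0) < r"
    proof (intro exI[of _ N] allI impI)
      fix i assume "N \<le> i"
      from N[OF this] have "r / 2 + 1 / Suc i * exp (2 / (r / 2)) < r" by linarith
      moreover have "\<bar>p - \<psi> * expectation (g i)\<bar> \<le> r / 2 + 1 / Suc i * exp (2 / (r / 2))"
        using damped_identity[OF t a \<delta>, of "r / 2" i] r unfolding p_def \<psi>_def g_def z_def w_def by simp
      ultimately show "norm (p - \<psi> * expectation (g i) - 0) < r" by simp
    qed
  qed
  then have "(\<lambda>i. (p - (p - \<psi> * expectation (g i))) / \<psi>) \<longlonglongrightarrow> (p - 0) / \<psi>"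
    using \<psi> by (intro tendsto_intros) auto
  then have ilim: "(\<lambda>i. expectation (g i)) \<longlonglongrightarrow> p / \<psi>" using \<psi> by simp
  have G: "integrable P (\<lambda>\<omega>. 1 / w \<omega> * exp (2 * z \<omega>))"
    "expectation (\<lambda>\<omega>. 1 / w \<omega> * exp (2 * z \<omega>)) = p / \<psi>"
    by (rule integral_monotone_convergence_nonneg[of P g]; use gi gmono g0 glim ilim in simp)+
  \<comment> \<open>The factor a^2 of the theorem arises here: a^2 times exp (-2/a) / a is psi,
    which cancels the denominator of p / psi.\<close>
  have u: "u \<omega> = exp (- 2 / a) / a * (1 / w \<omega> * exp (2 * z \<omega>))" for \<omega>
  proof -
    have aw: "a + exp_functional B t \<omega> = a * w \<omega>" using a by (simp add: w_def field_simps)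
    have "2 * exp_martingale B t \<omega> / (a * w \<omega>) - 2 / a = - 2 / a + 2 * z \<omega>"
      by (simp add: z_def)
    then have "exp (2 * exp_martingale B t \<omega> / (a * w \<omega>) - 2 / a) = exp (- 2 / a) * exp (2 * z \<omega>)"
      by (simp only: exp_add)
    then show ?thesis
      unfolding u_def aw by (simp add: inverse_eq_divide)
  qed
  show "integrable P u" unfolding u[abs_def] by (intro integrable_mult_right G)
  have "expectation u = exp (- 2 / a) / a * (p / \<psi>)"
    unfolding u[abs_def] integral_mult_right_zero G(2) ..
  then show "expectation (\<lambda>\<omega>. max (a - exp_functional B t \<omega>) 0) = a\<^sup>2 * expectation u"
    using a by (simp add: p_def \<psi>_def power2_eq_square)
qed

end

theorem proposition6p4:
  fixes P :: "'w measure" and B :: "real \<Rightarrow> 'w \<Rightarrow> real" and a t :: real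
  defines "M \<equiv> exp_martingale B" and "A \<equiv> exp_functional B"
  assumes "standard_brownian_motion P B" and "a > 0" and "t \<ge> 0"
  shows "integrable P (\<lambda>\<omega>. max (A t \<omega> - a) 0)
    \<and> integrable P (\<lambda>\<omega>. inverse (a + A t \<omega>) * exp (2 * M t \<omega> / (a + A t \<omega>) - 2 / a))
    \<and> (LINT \<omega>|P. max (A t \<omega> - a) 0) =
        t - a + a\<^sup>2 * (LINT \<omega>|P. inverse (a + A t \<omega>) * exp (2 * M t \<omega> / (a + A t \<omega>) - 2 / a))"
proof -
  interpret standard_brownian_motion P B by fact
  show ?thesis
  \<comment> \<open>A grid of positive mesh requires t > 0. At t = 0 the identity reads 0 = -a + a^2
    / a, with A identically 0 and M equal to 1 almost surely.\<close>
  proof (cases "t = 0")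
    case True
    have A0: "A 0 \<omega> = 0" for \<omega>
      unfolding A_def exp_functional_def set_lebesgue_integral_def
      by (rule integral_eq_zero_AE, rule eventually_mono[OF AE_lborel_singleton[of 0]]) auto
    have [measurable]: "M 0 \<in> borel_measurable P"
      unfolding M_def by (intro measurable_exp_martingale) simp
    have M0: "AE \<omega> in P. inverse (a + A 0 \<omega>) * exp (2 * M 0 \<omega> / (a + A 0 \<omega>) - 2 / a) = 1 / a"
      using start by eventually_elim (simp add: A0 M_def exp_martingale_def inverse_eq_divide)
    have "integrable P (\<lambda>\<omega>. inverse (a + A 0 \<omega>) * exp (2 * M 0 \<omega> / (a + A 0 \<omega>) - 2 / a))"
      by (subst integrable_cong_AE[OF _ _ M0]) (simp_all add: A0)
    moreover have "expectation (\<lambda>\<omega>. inverse (a + A 0 \<omega>) * exp (2 * M 0 \<omega> / (a + A 0 \<omega>) - 2 / a)) = 1 / a"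
      by (subst integral_cong_AE[OF _ _ M0]) (simp_all add: A0 prob_space)
    ultimately show ?thesis
      using \<open>a > 0\<close> unfolding True by (simp add: A0 power2_eq_square)
  next
    case False
    then have t: "0 < t" using \<open>t \<ge> 0\<close> by simp
    note [measurable] = measurable_exp_functional[OF t]
    have put: "integrable P (\<lambda>\<omega>. max (a - A t \<omega>) 0)"
      using exp_functional_nonneg[of t] \<open>a > 0\<close> unfolding A_def
      by (intro integrable_const_bound[of _ a] AE_I2) auto
    \<comment> \<open>Put-call parity: the integrability of the call is inherited from that of A and
      of the bounded put.\<close>
    have call: "max (A t \<omega> - a) 0 = A t \<omega> - a + max (a - A t \<omega>) 0" for \<omega> by (simp add: max_def)
    note mean = exp_functional_mean[OF t, folded A_def]
    show ?thesis
      using put_identity[OF t \<open>a > 0\<close>, folded A_def M_def] put mean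
      unfolding call by (simp add: prob_space)
  qed
qed

end
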